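(* Suppose $\eta$ is a (sample continuous) simple max-stable random field on a locally compact metric space $T$. If $S_1$ and $S_2$ are finite or countable disjoint closed subsets of $T$, then $$\beta(S_1,S_2)\leq 4\sum_{s_1\in S_1}\sum_{s_2\in S_2}[2-\theta(s_1,s_2)].$$
   Context: A random field $\eta=(\eta(t))_{t\in T}$ with continuous sample paths is simple max-stable if it is max-stable with standard unit Fréchet marginals: $\mathbb P[\eta(t)\le y]=\exp[-y^{-1}]1_{\{y>0\}}$ for $y\in\mathbb R$, $t\in T$, and for every $n\ge1$ the pointwise maximum of $n$ i.i.d. copies of $\eta$ has the same law as $n\eta$. The extremal coefficient function $\theta(s_1,s_2)$ is defined, for $s_1,s_2\in T$, by $\mathbb P[\max(\eta(s_1),\eta(s_2))\le y]=\exp[-\theta(s_1,s_2)y^{-1}]$, $y>0$. Mixing coefficient. For closed $S\subset T$, $\mathcal P_S$ is the distribution of the restriction $\eta_S$ of $\eta$ to $S$, on the space $\mathbb C(S)$ of continuous functions on $S$ (topology of uniform convergence on compact sets) with its Borel $\sigma$-field $\mathcal C_S$. For disjoint closed $S_1,S_2$, $\mathbb C(S_1\cup S_2)$ is identified with $\mathbb C(S_1)\times\mathbb C(S_2)$, and $$\beta(S_1,S_2)=\sup\{|\mathcal P_{S_1\cup S_2}(C)-(\mathcal P_{S_1}\otimes\mathcal P_{S_2})(C)|:\ C\in\mathcal C_{S_1\cup S_2}\}.$$ *)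

theory Defs
  imports "HOL-Probability.Probability"
begin

text \<open>
  The index space \<open>T\<close> is the universe of a type of class \<^class>\<open>metric_space\<close>.
  Elements of \<open>\<C>(S)\<close> are represented by functions that are extensional on \<open>S\<close>
  (equal to \<^const>\<open>undefined\<close> off \<open>S\<close>), so that equality in the type agrees with
  equality on \<open>S\<close>.
\<close>

definition cont_funs :: "'a::metric_space set \<Rightarrow> ('a \<Rightarrow> real) set" where
  "cont_funs S = {f \<in> extensional S. continuous_on S f}"

definition compact_ball :: "'a::metric_space set \<Rightarrow> ('a \<Rightarrow> real) \<Rightarrow> 'a set \<Rightarrow> real \<Rightarrow> ('a \<Rightarrow> real) set" where
  "compact_ball S f K e = {g \<in> cont_funs S. \<forall>x\<in>K. dist (g x) (f x) < e}"

text \<open>The topology on \<open>\<C>(S)\<close> of uniform convergence on compact subsets of \<open>S\<close>.\<close>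

definition ucc_topology :: "'a::metric_space set \<Rightarrow> ('a \<Rightarrow> real) topology" where
  "ucc_topology S = topology (\<lambda>U. U \<subseteq> cont_funs S \<and>
     (\<forall>f\<in>U. \<exists>K e. compact K \<and> K \<subseteq> S \<and> 0 < e \<and> compact_ball S f K e \<subseteq> U))"

lemma istopology_ucc:
  "istopology (\<lambda>U. U \<subseteq> cont_funs S \<and>
     (\<forall>f\<in>U. \<exists>K e. compact K \<and> K \<subseteq> S \<and> 0 < e \<and> compact_ball S f K e \<subseteq> U))"
  unfolding istopology_def
proof (rule conjI; intro allI impI conjI ballI)
  fix U V f
  assume U: "U \<subseteq> cont_funs S \<and>
     (\<forall>f\<in>U. \<exists>K e. compact K \<and> K \<subseteq> S \<and> 0 < e \<and> compact_ball S f K e \<subseteq> U)"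
    and V: "V \<subseteq> cont_funs S \<and>
     (\<forall>f\<in>V. \<exists>K e. compact K \<and> K \<subseteq> S \<and> 0 < e \<and> compact_ball S f K e \<subseteq> V)"
    and f: "f \<in> U \<inter> V"
  from U f obtain K d where K: "compact K" "K \<subseteq> S" "0 < d" "compact_ball S f K d \<subseteq> U"
    by (meson IntD1)
  from V f obtain L e where L: "compact L" "L \<subseteq> S" "0 < e" "compact_ball S f L e \<subseteq> V"
    by (meson IntD2)
  have "compact_ball S f (K \<union> L) (min d e) \<subseteq> compact_ball S f K d \<inter> compact_ball S f L e"
    by (simp add: compact_ball_def subset_iff)
  then have "compact_ball S f (K \<union> L) (min d e) \<subseteq> U \<inter> V"
    using K(4) L(4) by (meson Int_mono subset_trans)
  moreover have "compact (K \<union> L)" "K \<union> L \<subseteq> S" "0 < min d e"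
    using K L by (simp_all add: compact_Un)
  ultimately show "\<exists>K e. compact K \<and> K \<subseteq> S \<and> 0 < e \<and> compact_ball S f K e \<subseteq> U \<inter> V"
    by (intro exI conjI)
next
  fix U V :: "('a \<Rightarrow> real) set"
  assume "U \<subseteq> cont_funs S \<and>
     (\<forall>f\<in>U. \<exists>K e. compact K \<and> K \<subseteq> S \<and> 0 < e \<and> compact_ball S f K e \<subseteq> U)"
  then show "U \<inter> V \<subseteq> cont_funs S" by (simp add: le_infI1)
next
  fix \<K>
  assume K: "\<forall>U\<in>\<K>. U \<subseteq> cont_funs S \<and>
     (\<forall>f\<in>U. \<exists>K e. compact K \<and> K \<subseteq> S \<and> 0 < e \<and> compact_ball S f K e \<subseteq> U)"
  then show "\<Union>\<K> \<subseteq> cont_funs S" by (simp add: Sup_le_iff)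
  fix f assume "f \<in> \<Union>\<K>"
  then obtain U where U: "U \<in> \<K>" "f \<in> U" by (rule UnionE)
  with K obtain K e where *: "compact K" "K \<subseteq> S" "0 < e" "compact_ball S f K e \<subseteq> U"
    by meson
  from *(4) U(1) have "compact_ball S f K e \<subseteq> \<Union>\<K>"
    by (simp add: Sup_upper subset_trans)
  with * show "\<exists>K e. compact K \<and> K \<subseteq> S \<and> 0 < e \<and> compact_ball S f K e \<subseteq> \<Union>\<K>"
    by (intro exI conjI)
qed

lemma openin_ucc_topology:
  "openin (ucc_topology S) U \<longleftrightarrow> U \<subseteq> cont_funs S \<and>
     (\<forall>f\<in>U. \<exists>K e. compact K \<and> K \<subseteq> S \<and> 0 < e \<and> compact_ball S f K e \<subseteq> U)"
  by (simp only: ucc_topology_def topology_inverse'[OF istopology_ucc])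

definition cont_borel :: "'a::metric_space set \<Rightarrow> ('a \<Rightarrow> real) measure" where
  "cont_borel S = sigma (cont_funs S) {U. openin (ucc_topology S) U}"

lemma space_cont_borel [simp]: "space (cont_borel S) = cont_funs S"
  unfolding cont_borel_def by (rule space_measure_of) (auto simp: openin_ucc_topology)

lemma sets_cont_borel:
  "sets (cont_borel S) = sigma_sets (cont_funs S) {U. openin (ucc_topology S) U}"
  unfolding cont_borel_def by (rule sets_measure_of) (auto simp: openin_ucc_topology)

definition continuous_random_field :: "'w measure \<Rightarrow> ('a::metric_space \<Rightarrow> 'w \<Rightarrow> real) \<Rightarrow> bool" where
  "continuous_random_field M \<eta> \<longleftrightarrow>
     prob_space M \<and> (\<forall>t. \<eta> t \<in> borel_measurable M) \<and>
     (\<forall>\<omega>\<in>space M. continuous_on UNIV (\<lambda>t. \<eta> t \<omega>))"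

text \<open>
  The \<open>n\<close> i.i.d. copies of \<open>\<eta>\<close> are realised as the coordinates \<open>\<eta> t (w i)\<close>, \<open>i < n\<close>, on the
  \<open>n\<close>-fold product of the underlying probability space; the law of their maximum does
  not depend on the realisation. The law of a field indexed by all of \<open>T\<close> is taken on the product
  \<open>\<sigma>\<close>-field, i.e. it is given by the finite-dimensional distributions.
\<close>

definition simple_max_stable :: "'w measure \<Rightarrow> ('a::metric_space \<Rightarrow> 'w \<Rightarrow> real) \<Rightarrow> bool" where
  "simple_max_stable M \<eta> \<longleftrightarrow>
     continuous_random_field M \<eta> \<and>
     (\<forall>t y. measure M {\<omega> \<in> space M. \<eta> t \<omega> \<le> y} = (if 0 < y then exp (- (1 / y)) else 0)) \<and>
     (\<forall>n::nat. 1 \<le> n \<longrightarrow>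
        distr (Pi\<^sub>M {..<n} (\<lambda>_. M)) (Pi\<^sub>M UNIV (\<lambda>_. borel)) (\<lambda>w t. MAX i\<in>{..<n}. \<eta> t (w i)) =
        distr M (Pi\<^sub>M UNIV (\<lambda>_. borel)) (\<lambda>\<omega> t. real n * \<eta> t \<omega>))"

definition extremal_coeff :: "'w measure \<Rightarrow> ('a \<Rightarrow> 'w \<Rightarrow> real) \<Rightarrow> 'a \<Rightarrow> 'a \<Rightarrow> real" where
  "extremal_coeff M \<eta> s\<^sub>1 s\<^sub>2 = (THE \<theta>. \<forall>y>0.
     measure M {\<omega> \<in> space M. max (\<eta> s\<^sub>1 \<omega>) (\<eta> s\<^sub>2 \<omega>) \<le> y} = exp (- (\<theta> / y)))"

definition law_on :: "'w measure \<Rightarrow> ('a::metric_space \<Rightarrow> 'w \<Rightarrow> real) \<Rightarrow> 'a set \<Rightarrow> ('a \<Rightarrow> real) measure" where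
  "law_on M \<eta> S = distr M (cont_borel S) (\<lambda>\<omega>. restrict (\<lambda>t. \<eta> t \<omega>) S)"

text \<open>
  For disjoint closed \<open>S\<^sub>1\<close>, \<open>S\<^sub>2\<close> the map \<^term>\<open>merge S\<^sub>1 S\<^sub>2\<close> is the identification of
  \<open>\<C>(S\<^sub>1) \<times> \<C>(S\<^sub>2)\<close> with \<open>\<C>(S\<^sub>1 \<union> S\<^sub>2)\<close>; the product law is transported along it.
\<close>

definition mixing_coeff :: "'w measure \<Rightarrow> ('a::metric_space \<Rightarrow> 'w \<Rightarrow> real) \<Rightarrow> 'a set \<Rightarrow> 'a set \<Rightarrow> real" where
  "mixing_coeff M \<eta> S\<^sub>1 S\<^sub>2 =
     (SUP C \<in> sets (cont_borel (S\<^sub>1 \<union> S\<^sub>2)).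
        \<bar>measure (law_on M \<eta> (S\<^sub>1 \<union> S\<^sub>2)) C -
         measure (distr (law_on M \<eta> S\<^sub>1 \<Otimes>\<^sub>M law_on M \<eta> S\<^sub>2) (cont_borel (S\<^sub>1 \<union> S\<^sub>2)) (merge S\<^sub>1 S\<^sub>2)) C\<bar>)"

end

theory Submission
  imports Defs
begin

text \<open>
  The proof is a Lindeberg replacement argument. By max-stability, the laws of
  \<open>(\<eta>\<^bsub>S\<^sub>1\<^esub>, \<eta>\<^bsub>S\<^sub>2\<^esub>)\<close> and of the pair with independent blocks are, up to scaling by \<open>n\<close>, the laws of
  the maximum of \<open>n\<close> i.i.d. copies of either pair. Replacing the second block by a fresh copy one
  index at a time changes the probability of an event, at each step, by at most twice the probability
  that the new term exceeds the maximum of the others both on \<open>S\<^sub>1\<close> and on \<open>S\<^sub>2\<close>, computed once with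
  coupled and once with independent blocks. For a pair of points this exceedance probability is
  at most \<open>2 (2/n - \<theta>/(\<theta> + n - 1))\<close>, where \<open>\<theta> = 2\<close> for independent points, so the \<open>n\<close> steps contribute
  at most \<open>4 (2 - \<theta>)\<close> per pair in the limit. Events depending on finitely many points suffice
  because on a countable set the Borel sets of \<open>\<C>(S)\<close> are generated by the evaluations.
\<close>

subsection \<open>Borel sets of continuous functions on a countable set\<close>

text \<open>At a single point a new term exceeds n - 1 others with probability 1/n, so counting such
  events over n steps would leave a constant even for independent blocks. Hence the increment is
  compared with the one obtained when only the second block receives the new term. That one has mean
  zero, and the comparison leaves simultaneous exceedance on both blocks, where each pair costs only
  (2 - \<theta>)/n to first order, up to a constant factor.

  Simultaneous exceedance at s and t involves the joint law of two remaining maxima, which \<theta>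
  does not determine. But the smaller of these maxima then lies below both new terms, so one of two
  events occurs, each with a single maximum of i.i.d. unit Frechet variables and an explicit
  probability. This doubling and the bound 2 on a combination of four indicators make up the
  constant 4. Only one-point laws and laws of pair maxima enter, which is why the result is a double
  sum of pair coefficients.\<close>

lemma borel_measurable_cont_borel_eval:
  assumes "s \<in> S"
  shows "(\<lambda>f. f s) \<in> borel_measurable (cont_borel S)"
proof (rule borel_measurableI)
  fix B :: "real set" assume B: "open B"
  have "openin (ucc_topology S) ((\<lambda>f. f s) -` B \<inter> cont_funs S)"
    unfolding openin_ucc_topology
  proof (intro conjI ballI)
    fix f assume f: "f \<in> (\<lambda>f. f s) -` B \<inter> cont_funs S"
    with B obtain e where e: "0 < e" "\<And>y. dist y (f s) < e \<Longrightarrow> y \<in> B"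
      unfolding open_dist by auto
    show "\<exists>K e. compact K \<and> K \<subseteq> S \<and> 0 < e \<and>
        compact_ball S f K e \<subseteq> (\<lambda>f. f s) -` B \<inter> cont_funs S"
      by (rule exI[of _ "{s}"], rule exI[of _ e]) (use e assms in \<open>auto simp: compact_ball_def\<close>)
  qed auto
  then show "(\<lambda>f. f s) -` B \<inter> space (cont_borel S) \<in> sets (cont_borel S)"
    by (auto simp: sets_cont_borel)
qed

text \<open>For the nontrivial inclusion, every open \<open>U\<close> is a union of sets
  \<open>V L\<close>, each given by finitely many constraints "within \<open>r\<close> of
  \<open>q\<close> on a ball of radius \<open>1 / Suc k\<close> around \<open>s\<close>".
  Compactness makes finitely many balls suffice around each function of \<open>U\<close>.
  Countability of \<open>S\<close> enters twice: there are only countably many \<open>L\<close>, and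
  each \<open>V L\<close> is product measurable because its constraints run over countably many
  points.\<close>

lemma sets_cont_borel_countable:
  assumes S: "countable S"
  shows "sets (cont_borel S) = sets (restrict_space (Pi\<^sub>M S (\<lambda>_. borel)) (cont_funs S))"
    (is "_ = sets ?R")
proof (rule antisym)
  have space_R: "space ?R = cont_funs S"
    by (auto simp: space_restrict_space space_PiM PiE_def cont_funs_def)
  show "sets ?R \<subseteq> sets (cont_borel S)"
  proof
    fix A assume A: "A \<in> sets ?R"
    have "(\<lambda>f. f) \<in> measurable (cont_borel S) ?R"
    proof (intro measurable_restrict_space2 measurable_PiM_single')
      show "(\<lambda>f. f) \<in> space (cont_borel S) \<rightarrow> cont_funs S" by simp
      show "(\<lambda>f. f) \<in> space (cont_borel S) \<rightarrow> S \<rightarrow>\<^sub>E space borel"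
        by (simp add: cont_funs_def PiE_def)
    qed (rule borel_measurable_cont_borel_eval)
    from measurable_sets[OF this A] have "A \<inter> cont_funs S \<in> sets (cont_borel S)"
      by simp
    moreover have "A \<inter> cont_funs S = A"
      using sets.sets_into_space[OF A] unfolding space_R by (rule Int_absorb2)
    ultimately show "A \<in> sets (cont_borel S)" by simp
  qed
  define I :: "('a \<times> nat \<times> rat \<times> rat) set" where "I = S \<times> UNIV"
  define V where "V L = {g \<in> cont_funs S. \<forall>i\<in>L. case i of (s, k, q, r) \<Rightarrow>
      \<forall>x\<in>S. dist s x < 1 / Suc k \<longrightarrow> \<bar>g x - of_rat q\<bar> < of_rat r}"
    for L :: "('a \<times> nat \<times> rat \<times> rat) set"
  have V_sets: "V L \<in> sets ?R" if "finite L" for L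
  proof -
    have ev: "(\<lambda>g. g x) \<in> borel_measurable ?R" if "x \<in> S" for x
      using that by (intro measurable_restrict_space1) simp
    have "{g \<in> space ?R. \<forall>i\<in>L. \<forall>x\<in>{x \<in> S. dist (fst i) x < 1 / Suc (fst (snd i))}.
        \<bar>g x - of_rat (fst (snd (snd i)))\<bar> < of_rat (snd (snd (snd i)))} \<in> sets ?R"
    proof (intro sets.sets_Collect_countable_All')
      show "countable L" using that by (rule countable_finite)
      show "countable {x \<in> S. dist (fst i) x < 1 / Suc (fst (snd i))}" for i :: "'a \<times> nat \<times> rat \<times> rat"
        using S by (rule countable_subset[rotated]) auto
      fix i :: "'a \<times> nat \<times> rat \<times> rat" and x
      assume "x \<in> {x \<in> S. dist (fst i) x < 1 / Suc (fst (snd i))}"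
      then have [measurable]: "(\<lambda>g. g x) \<in> borel_measurable ?R" using ev by auto
      show "{g \<in> space ?R. \<bar>g x - of_rat (fst (snd (snd i)))\<bar> < of_rat (snd (snd (snd i)))} \<in> sets ?R"
        by measurable
    qed
    moreover have "{g \<in> space ?R. \<forall>i\<in>L. \<forall>x\<in>{x \<in> S. dist (fst i) x < 1 / Suc (fst (snd i))}.
        \<bar>g x - of_rat (fst (snd (snd i)))\<bar> < of_rat (snd (snd (snd i)))} = V L"
      unfolding space_R V_def by (intro Collect_cong conj_cong refl ball_cong) (auto split: prod.splits)
    ultimately show ?thesis by (simp only:)
  qed
  have "U \<in> sets ?R" if U: "openin (ucc_topology S) U" for U
  proof -
    let ?\<L> = "{L. (finite L \<and> L \<subseteq> I) \<and> V L \<subseteq> U}"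
    have cover: "f \<in> \<Union>(V ` ?\<L>)" if f: "f \<in> U" for f
    proof -
      obtain K e where K: "compact K" "K \<subseteq> S" "0 < e" "compact_ball S f K e \<subseteq> U"
        and fc: "f \<in> cont_funs S"
        using U f unfolding openin_ucc_topology by blast
      have "continuous_on S f" using fc by (simp add: cont_funs_def)
      \<comment> \<open>Two functions within \<open>r\<close> of the same \<open>q s\<close> differ
        by less than \<open>2 * r < e\<close>. Below, \<open>q s\<close> is chosen within
        \<open>r / 2\<close> of \<open>f s\<close>, leaving \<open>r / 2\<close> for the oscillation
        of \<open>f\<close> on the ball.\<close>
      obtain r :: rat where r: "0 < (of_rat r :: real)" "of_rat r < e / 2"
        using of_rat_dense[of 0 "e/2"] K(3) by auto
      have "\<exists>k q. \<forall>x\<in>S. dist s x < 1 / Suc k \<longrightarrow> \<bar>f x - of_rat q\<bar> < of_rat r" if s: "s \<in> S" for s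
      proof -
        obtain q where q: "f s < of_rat q" "of_rat q < f s + of_rat r / 2"
          using of_rat_dense[of "f s" "f s + of_rat r / 2"] r by auto
        obtain d where d: "0 < d" "\<And>x. x \<in> S \<Longrightarrow> dist x s < d \<Longrightarrow> dist (f x) (f s) < of_rat r / 2"
          using \<open>continuous_on S f\<close> s r unfolding continuous_on_iff
          by (metis half_gt_zero)
        obtain k where k: "1 / Suc k < d" using d(1) nat_approx_posE by blast
        show ?thesis
        proof (rule exI[of _ k], rule exI[of _ q], intro ballI impI)
          fix x assume "x \<in> S" "dist s x < 1 / Suc k"
          then have "dist (f x) (f s) < of_rat r / 2" using d(2)[of x] k by (simp add: dist_commute)
          then show "\<bar>f x - of_rat q\<bar> < of_rat r" using q unfolding dist_real_def by linarith
        qed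
      qed
      then obtain k q where kq: "\<And>s x. s \<in> S \<Longrightarrow> x \<in> S \<Longrightarrow> dist s x < 1 / Suc (k s)
          \<Longrightarrow> \<bar>f x - of_rat (q s)\<bar> < of_rat r"
        by metis
      have "K \<subseteq> (\<Union>s\<in>K. ball s (1 / Suc (k s)))" proof
        fix x assume "x \<in> K" then show "x \<in> (\<Union>s\<in>K. ball s (1 / Suc (k s)))"
          by (intro UN_I[of x]) simp_all
      qed
      then obtain C where C: "C \<subseteq> K" "finite C" "K \<subseteq> (\<Union>s\<in>C. ball s (1 / Suc (k s)))"
        using compactE_image[OF K(1), of K "\<lambda>s. ball s (1 / Suc (k s))"] by auto
      define L where "L = (\<lambda>s. (s, k s, q s, r)) ` C"
      have "finite L" "L \<subseteq> I" using C K(2) by (auto simp: L_def I_def)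
      have "f \<in> V L"
        unfolding V_def L_def
      proof (intro CollectI conjI fc ballI)
        fix i assume "i \<in> (\<lambda>s. (s, k s, q s, r)) ` C"
        then obtain s where s: "s \<in> C" "i = (s, k s, q s, r)" by blast
        then have "s \<in> S" using C(1) K(2) by blast
        then show "case i of (s, k, q, r) \<Rightarrow>
            \<forall>x\<in>S. dist s x < 1 / Suc k \<longrightarrow> \<bar>f x - of_rat q\<bar> < of_rat r"
          unfolding s(2) prod.case by (intro ballI impI kq)
      qed
      have "V L \<subseteq> compact_ball S f K e"
      proof
        fix g assume g: "g \<in> V L"
        have "dist (g x) (f x) < e" if x: "x \<in> K" for x
        proof -
          obtain s where s: "s \<in> C" "dist s x < 1 / Suc (k s)" using C(3) x by auto
          then have "\<bar>f x - of_rat (q s)\<bar> < of_rat r" using kq[of s x] x K(2) C(1) by auto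
          moreover have "\<bar>g x - of_rat (q s)\<bar> < of_rat r"
            using g s x K(2) by (auto simp: V_def L_def)
          ultimately show ?thesis using r unfolding dist_real_def by linarith
        qed
        then show "g \<in> compact_ball S f K e" using g by (simp add: compact_ball_def V_def)
      qed
      then have "V L \<subseteq> U" using K by auto
      with \<open>finite L\<close> \<open>L \<subseteq> I\<close> have "L \<in> ?\<L>" by simp
      then show ?thesis using \<open>f \<in> V L\<close> by (rule UN_I)
    qed
    have "U = \<Union>(V ` ?\<L>)"
    proof (intro subset_antisym)
      show "U \<subseteq> \<Union>(V ` ?\<L>)" by (rule subsetI) (rule cover)
      show "\<Union>(V ` ?\<L>) \<subseteq> U" by (intro UN_least) simp
    qed
    moreover have "countable ?\<L>"
    proof -
      have "countable I" unfolding I_def using S by (intro countable_SIGMA) auto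
      from countable_Collect_finite_subset[OF this] show ?thesis
        by (rule countable_subset[rotated]) auto
    qed
    then have "\<Union>(V ` ?\<L>) \<in> sets ?R"
      by (rule sets.countable_UN') (simp add: image_subset_iff V_sets)
    ultimately show ?thesis by (rule ssubst[where P="\<lambda>X. X \<in> sets ?R"])
  qed
  then show "sets (cont_borel S) \<subseteq> sets ?R"
    unfolding sets_cont_borel
    using sets.sigma_sets_subset[of "{U. openin (ucc_topology S) U}" ?R] by (auto simp: space_R)
qed

subsection \<open>Approximation by sets of an algebra\<close>

text \<open>Complements leave symmetric differences unchanged; a countable union is first cut to a
  finite one by continuity from below, and then its members are approximated one by one. A single
  \<open>A\<close> has to serve both measures, since they will be compared on that same set.\<close>

lemma (in algebra) finite_measure_approx:
  assumes "finite_measure P" "finite_measure Q"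
    and P: "sets P = sigma_sets \<Omega> M" and Q: "sets Q = sigma_sets \<Omega> M"
    and C: "C \<in> sigma_sets \<Omega> M" and e: "0 < (e::real)"
  shows "\<exists>A\<in>M. measure P (sym_diff C A) < e \<and> measure Q (sym_diff C A) < e"
  using C e
proof (induction arbitrary: e rule: sigma_sets.induct)
  case (Basic a) then show ?case by (intro bexI[of _ a]) auto
next
  case Empty then show ?case by (intro bexI[of _ "{}"]) auto
next
  case (Compl a)
  then obtain A where A: "A \<in> M" "measure P (sym_diff a A) < e" "measure Q (sym_diff a A) < e" by blast
  have "a \<subseteq> \<Omega>" using Compl(1) sigma_sets_into_sp space_closed by blast
  moreover have "A \<subseteq> \<Omega>" using A(1) space_closed by blast
  ultimately have "sym_diff (\<Omega> - a) (\<Omega> - A) = sym_diff a A" by blast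
  then show ?case using A by (intro bexI[of _ "\<Omega> - A"]) auto
next
  case (Union a)
  interpret P: finite_measure P by fact
  interpret Q: finite_measure Q by fact
  have aP: "a i \<in> sets P" and aQ: "a i \<in> sets Q" for i using Union(1) P Q by auto
  have MP: "A \<in> M \<Longrightarrow> A \<in> sets P" and MQ: "A \<in> M \<Longrightarrow> A \<in> sets Q" for A using P Q by auto
  have inc: "incseq (\<lambda>n. \<Union>i<n. a i)" by (fastforce simp: incseq_def)
  have UN: "(\<Union>n. \<Union>i<n. a i) = \<Union>(range a)" by blast
  have "(\<lambda>n. measure P (\<Union>i<n. a i)) \<longlonglongrightarrow> measure P (\<Union>(range a))"
    using P.finite_Lim_measure_incseq[OF _ inc] aP by (simp add: UN image_subset_iff)
  moreover have "(\<lambda>n. measure Q (\<Union>i<n. a i)) \<longlonglongrightarrow> measure Q (\<Union>(range a))"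
    using Q.finite_Lim_measure_incseq[OF _ inc] aQ by (simp add: UN image_subset_iff)
  ultimately have "\<forall>\<^sub>F n in sequentially. measure P (\<Union>(range a)) - e/2 < measure P (\<Union>i<n. a i) \<and>
      measure Q (\<Union>(range a)) - e/2 < measure Q (\<Union>i<n. a i)"
    using Union(3) by (intro eventually_conj order_tendstoD) auto
  then obtain n where n: "measure P (\<Union>(range a)) - e/2 < measure P (\<Union>i<n. a i)"
      "measure Q (\<Union>(range a)) - e/2 < measure Q (\<Union>i<n. a i)"
    by (auto simp: eventually_sequentially)
  \<comment> \<open>The \<open>n\<close> errors add up to at most \<open>e / 2\<close>;
    \<open>Suc n\<close> instead of \<open>n\<close> keeps the tolerance positive if the cut is at
    \<open>n = 0\<close>.\<close>
  have "\<exists>A\<in>M. measure P (sym_diff (a i) A) < e / (2 * Suc n) \<and> measure Q (sym_diff (a i) A) < e / (2 * Suc n)"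
    for i using Union(3) by (intro Union(2)) auto
  then obtain A where A: "\<And>i. A i \<in> M" "\<And>i. measure P (sym_diff (a i) (A i)) < e / (2 * Suc n)"
    "\<And>i. measure Q (sym_diff (a i) (A i)) < e / (2 * Suc n)" by metis
  have bound: "measure R (sym_diff (\<Union>(range a)) (\<Union>i<n. A i)) < e"
    if "finite_measure R" and aR: "\<And>i. a i \<in> sets R" and AR: "\<And>i. A i \<in> sets R"
      and nR: "measure R (\<Union>(range a)) - e/2 < measure R (\<Union>i<n. a i)"
      and mR: "\<And>i. measure R (sym_diff (a i) (A i)) < e / (2 * Suc n)" for R
  proof -
    interpret R: finite_measure R by fact
    have "measure R (sym_diff (\<Union>(range a)) (\<Union>i<n. A i))
       \<le> measure R ((\<Union>(range a) - (\<Union>i<n. a i)) \<union> (\<Union>i<n. sym_diff (a i) (A i)))"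
      by (rule R.finite_measure_mono) (use aR AR in \<open>auto intro!: sets.Un sets.Diff sets.countable_UN\<close>)
    also have "\<dots> \<le> measure R (\<Union>(range a) - (\<Union>i<n. a i)) + measure R (\<Union>i<n. sym_diff (a i) (A i))"
      by (rule measure_Un_le) (use aR AR in \<open>auto intro!: sets.Un sets.Diff sets.countable_UN\<close>)
    also have "measure R (\<Union>(range a) - (\<Union>i<n. a i)) = measure R (\<Union>(range a)) - measure R (\<Union>i<n. a i)"
      by (rule R.finite_measure_Diff) (use aR in \<open>auto intro!: sets.countable_UN\<close>)
    also have "measure R (\<Union>i<n. sym_diff (a i) (A i)) \<le> (\<Sum>i<n. measure R (sym_diff (a i) (A i)))"
      by (rule measure_UNION_le) (use aR AR in auto)
    also have "\<dots> \<le> (\<Sum>i<n. e / (2 * Suc n))"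
      using mR by (intro sum_mono less_imp_le)
    also have "\<dots> \<le> e / 2" using Union(3) by (simp add: field_simps)
    finally show ?thesis using nR by linarith
  qed
  have "(\<Union>i<n. A i) \<in> M" using A(1) by auto
  then show ?case
    by (rule bexI[rotated])
      (intro conjI bound[OF assms(1) aP MP[OF A(1)] n(1) A(2)] bound[OF assms(2) aQ MQ[OF A(1)] n(2) A(3)])
qed

lemma (in algebra) abs_measure_diff_le:
  assumes "finite_measure P" "finite_measure Q"
    and P: "sets P = sigma_sets \<Omega> M" and Q: "sets Q = sigma_sets \<Omega> M"
    and b: "\<And>A. A \<in> M \<Longrightarrow> \<bar>measure P A - measure Q A\<bar> \<le> b"
    and C: "C \<in> sigma_sets \<Omega> M"
  shows "\<bar>measure P C - measure Q C\<bar> \<le> b"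
proof (rule field_le_epsilon)
  fix e :: real assume e: "0 < e"
  obtain A where A: "A \<in> M" "measure P (sym_diff C A) < e/2" "measure Q (sym_diff C A) < e/2"
    using finite_measure_approx[OF assms(1-4) C, of "e/2"] e by auto
  have *: "\<bar>measure R C - measure R A\<bar> \<le> measure R (sym_diff C A)"
    if "finite_measure R" "C \<in> sets R" "A \<in> sets R" for R
  proof -
    interpret R: finite_measure R by fact
    have "measure R C \<le> measure R A + measure R (sym_diff C A)"
      by (rule order_trans[OF R.finite_measure_mono measure_Un_le]) (use that in auto)
    moreover have "measure R A \<le> measure R C + measure R (sym_diff C A)"
      by (rule order_trans[OF R.finite_measure_mono measure_Un_le]) (use that in auto)
    ultimately show ?thesis by linarith
  qed
  have "\<bar>measure P C - measure P A\<bar> < e/2" "\<bar>measure Q C - measure Q A\<bar> < e/2"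
    using *[of P] *[of Q] A P Q C assms(1,2) by force+
  then show "\<bar>measure P C - measure Q C\<bar> \<le> b + e"
    using b[OF A(1)] by linarith
qed

subsection \<open>The extremal coefficient\<close>

text \<open>With \<open>m\<close> the integer part of \<open>n * t\<close>, both
  \<open>n * G t\<close> and \<open>n * t * G 1\<close> lie between \<open>m * G 1\<close> and
  \<open>(m + 1) * G 1\<close>. They differ by at most \<open>G 1\<close>, and dividing by
  \<open>n\<close> gives the claim in the limit.\<close>

lemma mono_homogeneous_linear:
  fixes G :: "real \<Rightarrow> real"
  assumes mono: "\<And>s t. 0 < s \<Longrightarrow> s \<le> t \<Longrightarrow> G s \<le> G t"
    and hom: "\<And>n t. 1 \<le> n \<Longrightarrow> 0 < t \<Longrightarrow> G (real n * t) = real n * G t"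
    and t: "0 < t"
  shows "G t = t * G 1"
proof -
  have "G 1 \<le> 2 * G 1" using mono[of 1 2] hom[of 2 1] by simp
  then have G1: "0 \<le> G 1" by simp
  have "(\<lambda>n. G 1 / real n) \<longlonglongrightarrow> 0"
    by (rule tendsto_divide_0[OF tendsto_const filterlim_at_top_imp_at_infinity[OF filterlim_real_sequentially]])
  \<comment> \<open>The threshold ensures \<open>n * t \<ge> 1\<close>, hence
    \<open>m \<ge> 1\<close>: monotonicity is assumed at positive arguments and homogeneity for
    positive multiples only.\<close>
  moreover have "\<bar>G t - t * G 1\<bar> \<le> G 1 / real n" if n: "n \<ge> nat \<lceil>1 / t\<rceil> + 1" for n
  proof -
    define m where "m = nat \<lfloor>real n * t\<rfloor>"
    have "1 / t \<le> real n" using n by linarith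
    then have nt: "1 \<le> real n * t" using t by (simp add: field_simps)
    then have m1: "1 \<le> m" unfolding m_def by linarith
    have m: "real m \<le> real n * t" "real n * t \<le> real (Suc m)" using nt unfolding m_def by linarith+
    have n1: "1 \<le> n" using n by simp
    have "real m * G 1 \<le> real n * G t"
      using mono[of "real m" "real n * t"] hom[OF m1, of 1] hom[OF n1 t] m m1 by simp
    moreover have "real n * G t \<le> real (Suc m) * G 1"
      using mono[of "real n * t" "real (Suc m)"] hom[of "Suc m" 1] hom[OF n1 t] m nt by simp
    moreover have "real m * G 1 \<le> (real n * t) * G 1" "(real n * t) * G 1 \<le> real (Suc m) * G 1"
      using m G1 by (intro mult_right_mono; simp)+
    ultimately have "\<bar>real n * G t - real n * t * G 1\<bar> \<le> G 1"
      by (simp add: algebra_simps abs_le_iff)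
    also have "real n * G t - real n * t * G 1 = real n * (G t - t * G 1)" by (simp add: algebra_simps)
    finally have "real n * \<bar>G t - t * G 1\<bar> \<le> G 1" by (simp only: abs_mult abs_of_nat)
    then show ?thesis using n1 by (simp add: pos_le_divide_eq mult.commute)
  qed
  then have "\<forall>\<^sub>F n in sequentially. \<bar>G t - t * G 1\<bar> \<le> G 1 / real n"
    unfolding eventually_sequentially by blast
  ultimately have "\<bar>G t - t * G 1\<bar> \<le> 0"
    by (intro tendsto_lowerbound) auto
  then show ?thesis by simp
qed

lemma simple_max_stableD:
  assumes "simple_max_stable M \<eta>"
  shows "prob_space M" "\<eta> t \<in> borel_measurable M"
    "\<omega> \<in> space M \<Longrightarrow> continuous_on S (\<lambda>t. \<eta> t \<omega>)"
    "0 < y \<Longrightarrow> measure M {\<omega> \<in> space M. \<eta> t \<omega> \<le> y} = exp (- (1 / y))"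
    "measure M {\<omega> \<in> space M. \<eta> t \<omega> \<le> 0} = 0"
  using assms by (auto simp: simple_max_stable_def continuous_random_field_def intro: continuous_on_subset)

lemma max_stable_measure:
  fixes \<eta> :: "'a::metric_space \<Rightarrow> 'w \<Rightarrow> real"
  assumes ms: "simple_max_stable M \<eta>" and n: "1 \<le> n" and B: "B \<in> sets (Pi\<^sub>M UNIV (\<lambda>_. borel))"
  shows "measure (Pi\<^sub>M {..<n} (\<lambda>_. M))
      {w \<in> space (Pi\<^sub>M {..<n} (\<lambda>_. M)). (\<lambda>t. MAX i\<in>{..<n}. \<eta> t (w i)) \<in> B} =
    measure M {\<omega> \<in> space M. (\<lambda>t. real n * \<eta> t \<omega>) \<in> B}"
proof -
  note [measurable] = simple_max_stableD(2)[OF ms]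
  let ?N = "Pi\<^sub>M {..<n} (\<lambda>_. M)" and ?R = "Pi\<^sub>M UNIV (\<lambda>_. borel) :: ('a \<Rightarrow> real) measure"
  have *: "(\<lambda>w t. MAX i\<in>{..<n}. \<eta> t (w i)) \<in> measurable ?N ?R"
    by (rule measurable_PiM_single') (auto intro!: borel_measurable_Max)
  have **: "(\<lambda>\<omega> t. real n * \<eta> t \<omega>) \<in> measurable M ?R"
    by (rule measurable_PiM_single') auto
  have "measure (distr ?N ?R (\<lambda>w t. MAX i\<in>{..<n}. \<eta> t (w i))) B =
      measure (distr M ?R (\<lambda>\<omega> t. real n * \<eta> t \<omega>)) B"
    using ms n by (simp add: simple_max_stable_def)
  then show ?thesis
    by (simp add: measure_distr[OF * B] measure_distr[OF ** B] vimage_def Int_def conj_commute)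
qed

text \<open>Max-stability on the event that both coordinates are at most \<open>y\<close> gives
  \<open>F y ^ n = F (y / n)\<close>, so \<open>- ln (F (1 / u))\<close> is monotone and homogeneous
  in \<open>u\<close>, hence linear. This shows that the description defining the coefficient is met
  by exactly one number. Comparison with one marginal gives \<open>\<theta> \<ge> 1\<close>;
  inclusion-exclusion, evaluated at a large \<open>y\<close>, gives
  \<open>\<theta> \<le> 2\<close>.\<close>

lemma max_stable_extremal_coeff:
  fixes \<eta> :: "'a::metric_space \<Rightarrow> 'w \<Rightarrow> real"
  assumes ms: "simple_max_stable M \<eta>"
  shows "0 < y \<Longrightarrow> measure M {\<omega> \<in> space M. max (\<eta> s \<omega>) (\<eta> t \<omega>) \<le> y} = exp (- (extremal_coeff M \<eta> s t / y))"
    and "0 < extremal_coeff M \<eta> s t" and "extremal_coeff M \<eta> s t \<le> 2"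
proof -
  note [measurable] = simple_max_stableD(2)[OF ms]
  interpret prob_space M using ms by (rule simple_max_stableD)
  define F where "F y = prob {\<omega> \<in> space M. max (\<eta> s \<omega>) (\<eta> t \<omega>) \<le> y}" for y
  have F_mono: "F x \<le> F y" if "x \<le> y" for x y
    unfolding F_def using that by (intro finite_measure_mono) auto
  have F_le: "F y \<le> exp (- (1 / y))" if "0 < y" for y
    unfolding F_def simple_max_stableD(4)[OF ms that, of s, symmetric] by (intro finite_measure_mono) auto
  have F_ge: "2 * exp (- (1 / y)) - 1 \<le> F y" if "0 < y" for y
  proof -
    have "prob {\<omega> \<in> space M. \<eta> s \<omega> \<le> y} + prob {\<omega> \<in> space M. \<eta> t \<omega> \<le> y} =
      prob ({\<omega> \<in> space M. \<eta> s \<omega> \<le> y} \<union> {\<omega> \<in> space M. \<eta> t \<omega> \<le> y}) +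
      prob ({\<omega> \<in> space M. \<eta> s \<omega> \<le> y} \<inter> {\<omega> \<in> space M. \<eta> t \<omega> \<le> y})"
      by (subst measure_Un3) (simp_all add: fmeasurable_eq_sets)
    moreover have "{\<omega> \<in> space M. \<eta> s \<omega> \<le> y} \<inter> {\<omega> \<in> space M. \<eta> t \<omega> \<le> y} =
      {\<omega> \<in> space M. max (\<eta> s \<omega>) (\<eta> t \<omega>) \<le> y}" by auto
    moreover have "prob ({\<omega> \<in> space M. \<eta> s \<omega> \<le> y} \<union> {\<omega> \<in> space M. \<eta> t \<omega> \<le> y}) \<le> 1" by simp
    ultimately show ?thesis using simple_max_stableD(4)[OF ms that] unfolding F_def by simp
  qed
  have F_pow: "F y ^ n = F (y / real n)" if n: "1 \<le> n" for n y
  proof -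
    let ?N = "Pi\<^sub>M {..<n} (\<lambda>_. M)"
    interpret P: finite_product_prob_space "\<lambda>_. M" "{..<n}" by unfold_locales simp
    have B: "{f \<in> space (Pi\<^sub>M UNIV (\<lambda>_. borel)). max (f s) (f t) \<le> y} \<in> sets (Pi\<^sub>M UNIV (\<lambda>_. borel))" (is "?B \<in> _")
      by measurable
    have "F (y / real n) = prob {\<omega> \<in> space M. (\<lambda>t. real n * \<eta> t \<omega>) \<in> ?B}"
      unfolding F_def using n by (intro arg_cong[where f=prob]) (auto simp: space_PiM field_simps)
    also have "\<dots> = measure ?N {w \<in> space ?N. (\<lambda>t. MAX i\<in>{..<n}. \<eta> t (w i)) \<in> ?B}"
      by (rule max_stable_measure[OF ms n B, symmetric])
    also have "{w \<in> space ?N. (\<lambda>t. MAX i\<in>{..<n}. \<eta> t (w i)) \<in> ?B} =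
       (\<Pi>\<^sub>E i\<in>{..<n}. {\<omega> \<in> space M. max (\<eta> s \<omega>) (\<eta> t \<omega>) \<le> y})"
    proof -
      have "(MAX i\<in>{..<n}. \<eta> t (w i)) \<le> y \<longleftrightarrow> (\<forall>i<n. \<eta> t (w i) \<le> y)" for t w
        using n by (subst Max_le_iff) (auto simp: lessThan_empty_iff)
      then show ?thesis by (intro set_eqI) (simp add: space_PiM PiE_iff, blast)
    qed
    also have "measure ?N \<dots> = (\<Prod>i<n. F y)"
      unfolding F_def by (rule P.prob_times) simp
    finally show ?thesis by simp
  qed
  \<comment> \<open>Needed before taking logarithms. Inclusion-exclusion yields
    \<open>F 4 \<ge> 1/2\<close>; monotonicity and \<open>F_pow\<close> carry positivity down to
    every \<open>y > 0\<close>.\<close>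
  have F_pos: "0 < F y" if y: "0 < y" for y
  proof -
    obtain n :: nat where "4 / y < n" using reals_Archimedean2 by blast
    then have n: "4 \<le> real n * y" "1 \<le> n" using y by (auto simp: field_simps Suc_le_eq intro!: Nat.gr0I)
    have "1 + - (1/4) \<le> exp (- (1 / 4 :: real))" by (rule exp_ge_add_one_self)
    then have "0 < F 4" using F_ge[of 4] by simp
    also have "F 4 \<le> F (real n * y)" using n by (intro F_mono)
    finally have "0 < F (real n * y) ^ n" by simp
    then show ?thesis using F_pow[of n "real n * y"] n by simp
  qed
  define \<theta> where "\<theta> = - ln (F 1)"
  have F_exp: "F y = exp (- (\<theta> / y))" if y: "0 < y" for y
  proof -
    define G where "G u = - ln (F (1 / u))" for u
    have "G (1 / y) = 1 / y * G 1"
    proof (rule mono_homogeneous_linear)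
      show "G a \<le> G b" if "0 < a" "a \<le> b" for a b
        unfolding G_def using that F_pos F_mono[of "1/b" "1/a"] by (simp add: frac_le)
      show "G (real n * u) = real n * G u" if "1 \<le> n" "0 < u" for n u
      proof -
        have "F (1 / (real n * u)) = F (1 / u) ^ n"
          using F_pow[of n "1/u"] that by (simp add: field_simps)
        then show ?thesis unfolding G_def using F_pos[of "1/u"] that by (simp add: ln_realpow)
      qed
    qed (use y in simp)
    then have "ln (F y) = - (\<theta> / y)" by (simp add: G_def \<theta>_def)
    then show ?thesis using F_pos[OF y] exp_ln[of "F y"] by simp
  qed
  have \<theta>: "extremal_coeff M \<eta> s t = \<theta>"
    unfolding extremal_coeff_def F_def[symmetric]
  proof (rule the_equality)
    show "\<forall>y>0. F y = exp (- (\<theta> / y))" using F_exp by simp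
    show "\<theta>' = \<theta>" if "\<forall>y>0. F y = exp (- (\<theta>' / y))" for \<theta>'
      using that[rule_format, of 1] F_exp[of 1] by simp
  qed
  show "0 < y \<Longrightarrow> measure M {\<omega> \<in> space M. max (\<eta> s \<omega>) (\<eta> t \<omega>) \<le> y} = exp (- (extremal_coeff M \<eta> s t / y))"
    using F_exp \<theta> by (simp add: F_def)
  have "exp (- \<theta>) \<le> exp (-1)" using F_le[of 1] F_exp[of 1] by simp
  then have "1 \<le> \<theta>" by simp
  then show "0 < extremal_coeff M \<eta> s t" using \<theta> by simp
  show "extremal_coeff M \<eta> s t \<le> 2"
    unfolding \<theta>
  proof (rule ccontr)
    assume *: "\<not> \<theta> \<le> 2"
    \<comment> \<open>Here \<open>u\<close> stands for \<open>1 / y\<close>. The chain \<open>1 - 2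
      * u \<le> exp (- (\<theta> * u)) \<le> 1 / (1 + \<theta> * u)\<close> forces
      \<open>\<theta> - 2 \<le> 2 * \<theta> * u\<close>, and this \<open>u\<close> makes the
      right-hand side half of the left.\<close>
    define u where "u = (\<theta> - 2) / (4 * \<theta>)"
    have u: "0 < u" using * by (simp add: u_def)
    have "1 + - u \<le> exp (- u)" by (rule exp_ge_add_one_self)
    then have "1 - 2 * u \<le> exp (- (\<theta> * u))"
      using F_ge[of "1 / u"] F_exp[of "1 / u"] u by (simp add: mult.commute)
    moreover have "(1 + \<theta> * u) * exp (- (\<theta> * u)) \<le> 1"
      using exp_ge_add_one_self[of "\<theta> * u"] by (simp add: exp_minus field_simps)
    moreover have "0 < 1 + \<theta> * u" using u * by (simp add: add_pos_pos)
    ultimately have "(1 + \<theta> * u) * (1 - 2 * u) \<le> 1"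
      using mult_left_mono[of "1 - 2 * u" "exp (- (\<theta> * u))" "1 + \<theta> * u"] by linarith
    then have "u * (\<theta> - 2) \<le> u * (2 * (\<theta> * u))" by (simp add: algebra_simps)
    then have "\<theta> - 2 \<le> 2 * (\<theta> * u)" using u by simp
    also have "\<dots> = (\<theta> - 2) / 2" using * by (simp add: u_def)
    finally show False using * by simp
  qed
qed

subsection \<open>Frechet variables\<close>

definition frechet_cdf :: "real \<Rightarrow> real \<Rightarrow> real" where
  "frechet_cdf c y = (if 0 < y then exp (- (c / y)) else 0)"

definition frechet :: "'w measure \<Rightarrow> real \<Rightarrow> ('w \<Rightarrow> real) \<Rightarrow> bool" where
  "frechet M c V \<longleftrightarrow> V \<in> borel_measurable M \<and>
     (\<forall>y. measure M {\<omega> \<in> space M. V \<omega> \<le> y} = frechet_cdf c y)"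

lemma borel_measurable_frechet_cdf [measurable]: "frechet_cdf c \<in> borel_measurable borel"
  unfolding frechet_cdf_def[abs_def] by measurable

lemma frechet_cdf_bounds: "0 \<le> c \<Longrightarrow> 0 \<le> frechet_cdf c y \<and> frechet_cdf c y \<le> 1"
  by (auto simp: frechet_cdf_def)

lemma frechet_cdf_power: "1 \<le> n \<Longrightarrow> frechet_cdf c y ^ n = frechet_cdf (real n * c) y"
  by (auto simp: frechet_cdf_def exp_of_nat_mult[symmetric] power_0_left)

lemma frechet_cdf_mult: "frechet_cdf c y * frechet_cdf d y = frechet_cdf (c + d) y"
  by (auto simp: frechet_cdf_def exp_add[symmetric] add_divide_distrib)

text \<open>A maximum lies below a level iff all its members do, with strict inequality throughout,
  so the exceedance events need the law at \<open><\<close>. It agrees with the law at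
  \<open>\<le>\<close> because the Frechet distribution function is left-continuous.\<close>

lemma (in prob_space) frechet_less:
  assumes V: "frechet M c V"
  shows "prob {\<omega> \<in> space M. V \<omega> < y} = frechet_cdf c y"
proof -
  have [measurable]: "V \<in> borel_measurable M" using V by (simp add: frechet_def)
  have le: "prob {\<omega> \<in> space M. V \<omega> \<le> x} = frechet_cdf c x" for x using V by (simp add: frechet_def)
  have "prob {\<omega> \<in> space M. V \<omega> < y} \<le> frechet_cdf c y"
    unfolding le[symmetric] by (intro finite_measure_mono) auto
  moreover have "frechet_cdf c y \<le> prob {\<omega> \<in> space M. V \<omega> < y}"
  proof (cases "0 < y")
    case True
    have "((\<lambda>x. exp (- (c / x))) \<longlongrightarrow> exp (- (c / y))) (at_left y)"
      using True by (intro tendsto_intros) auto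
    moreover have "\<forall>\<^sub>F x in at_left y. exp (- (c / x)) \<le> prob {\<omega> \<in> space M. V \<omega> < y}"
      using eventually_at_left_real[OF True]
    proof eventually_elim
      case (elim x)
      then have "exp (- (c / x)) = prob {\<omega> \<in> space M. V \<omega> \<le> x}" by (simp add: le frechet_cdf_def)
      also have "\<dots> \<le> prob {\<omega> \<in> space M. V \<omega> < y}" using elim by (intro finite_measure_mono) auto
      finally show ?case .
    qed
    ultimately have "exp (- (c / y)) \<le> prob {\<omega> \<in> space M. V \<omega> < y}"
      by (intro tendsto_upperbound) auto
    then show ?thesis using True by (simp add: frechet_cdf_def)
  qed (simp add: frechet_cdf_def)
  ultimately show ?thesis by (rule antisym)
qed

lemma (in prob_space) frechet_AE_pos:
  assumes V: "frechet M c V"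
  shows "AE \<omega> in M. 0 < V \<omega>"
proof -
  have [measurable]: "V \<in> borel_measurable M" using V by (simp add: frechet_def)
  have "prob {\<omega> \<in> space M. V \<omega> \<le> 0} = 0" using V by (simp add: frechet_def frechet_cdf_def)
  then have "AE \<omega> in M. \<not> V \<omega> \<le> 0" by (subst (asm) prob_eq_0) auto
  then show ?thesis by eventually_elim simp
qed

text \<open>The reciprocal of a Frechet variable is exponential.\<close>

lemma (in prob_space) frechet_expectation:
  assumes V: "frechet M c V" and c: "0 < c" and d: "0 \<le> d"
  shows "expectation (\<lambda>\<omega>. frechet_cdf d (V \<omega>)) = c / (c + d)"
proof -
  have [measurable]: "V \<in> borel_measurable M" using V by (simp add: frechet_def)
  have pos: "AE \<omega> in M. 0 < V \<omega>" by (rule frechet_AE_pos[OF V])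
  have D: "distributed M lborel (\<lambda>\<omega>. 1 / V \<omega>) (exponential_density c)"
    unfolding exponential_distributed_iff[OF c]
  proof (intro conjI allI impI)
    fix a :: real assume a: "0 \<le> a"
    \<comment> \<open>The case \<open>a = 0\<close> is handled apart: \<open>1 / a\<close> is then 0
      and is no longer the threshold for \<open>V\<close>.\<close>
    have "prob {\<omega> \<in> space M. 1 / V \<omega> \<le> a} = prob {\<omega> \<in> space M. \<not> V \<omega> < 1 / a}" if "0 < a"
      using pos by (intro finite_measure_eq_AE) (auto simp: field_simps that)
    moreover have "prob {\<omega> \<in> space M. \<not> V \<omega> < 1 / a} = 1 - prob {\<omega> \<in> space M. V \<omega> < 1 / a}"
      by (rule prob_neg) measurable
    moreover have "prob {\<omega> \<in> space M. 1 / V \<omega> \<le> a} = 0" if "a = 0"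
      using pos by (subst prob_eq_0) (auto simp: that)
    ultimately show "prob {\<omega> \<in> space M. 1 / V \<omega> \<le> a} = 1 - exp (- a * c)"
      using a frechet_less[OF V, of "1 / a"] by (cases "a = 0") (auto simp: frechet_cdf_def mult.commute)
  qed measurable
  have "expectation (\<lambda>\<omega>. frechet_cdf d (V \<omega>)) = expectation (\<lambda>\<omega>. exp (- d * (1 / V \<omega>)))"
    using pos by (intro integral_cong_AE) (auto simp: frechet_cdf_def)
  also have "\<dots> = (\<integral>t. exponential_density c t * exp (- d * t) \<partial>lborel)"
    by (rule distributed_integral[OF D, symmetric]) (use c in \<open>auto simp: exponential_density_nonneg\<close>)
  also have "\<dots> = (\<integral>t. c / (c + d) * exponential_density (c + d) t \<partial>lborel)"
  proof (intro Bochner_Integration.integral_cong refl)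
    fix t :: real
    have "c / (c + d) * (c + d) = c" using c d by simp
    moreover have "exp (- t * c) * exp (- d * t) = exp (- t * (c + d))"
      by (simp add: exp_add[symmetric] algebra_simps)
    ultimately show "exponential_density c t * exp (- d * t) =
        c / (c + d) * exponential_density (c + d) t"
      using c d by (simp add: exponential_density_def mult.assoc)
  qed
  also have "\<dots> = c / (c + d) * (\<integral>t. exponential_density (c + d) t \<partial>lborel)" by simp
  also have "(\<integral>t. exponential_density (c + d) t \<partial>lborel) = 1"
  proof -
    interpret E: prob_space "density lborel (exponential_density (c + d))"
      using c d by (intro prob_space_exponential_density) simp
    have "(\<integral>\<^sup>+t. exponential_density (c + d) t \<partial>lborel) = 1"
      using E.emeasure_space_1 by (simp add: emeasure_density)
    then show ?thesis
      using c d by (subst integral_eq_nn_integral) (auto simp: exponential_density_nonneg)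
  qed
  finally show ?thesis by simp
qed

lemma (in prob_space) frechet_min_expectation:
  assumes X: "frechet M 1 X" and Y: "frechet M 1 Y"
    and XY: "frechet M \<theta> (\<lambda>\<omega>. max (X \<omega>) (Y \<omega>))" and \<theta>: "0 < \<theta>" and d: "0 \<le> d"
  shows "expectation (\<lambda>\<omega>. frechet_cdf d (min (X \<omega>) (Y \<omega>))) = 2 / (1 + d) - \<theta> / (\<theta> + d)"
proof -
  have [measurable]: "X \<in> borel_measurable M" "Y \<in> borel_measurable M"
    using X Y by (simp_all add: frechet_def)
  have int: "integrable M (\<lambda>\<omega>. frechet_cdf d (W \<omega>))" if [measurable]: "W \<in> borel_measurable M" for W
    by (rule integrable_const_bound[where B=1]) (use frechet_cdf_bounds[OF d] in auto)
  have "frechet_cdf d (min (X \<omega>) (Y \<omega>)) =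
      frechet_cdf d (X \<omega>) + frechet_cdf d (Y \<omega>) - frechet_cdf d (max (X \<omega>) (Y \<omega>))" for \<omega>
    by (auto simp: min_def max_def)
  then show ?thesis
    using frechet_expectation[OF X _ d] frechet_expectation[OF Y _ d] frechet_expectation[OF XY \<theta> d]
    by (simp add: int)
qed

section \<open>Events and coordinate laws on finite powers of a probability space\<close>

lemma measure_PiM_restrict:
  assumes "prob_space M" "finite K" "L \<subseteq> K" and A: "A \<in> sets (Pi\<^sub>M L (\<lambda>_. M))"
  shows "measure (Pi\<^sub>M K (\<lambda>_. M)) {w \<in> space (Pi\<^sub>M K (\<lambda>_. M)). restrict w L \<in> A} = measure (Pi\<^sub>M L (\<lambda>_. M)) A"
proof -
  have "distr (Pi\<^sub>M K (\<lambda>_. M)) (Pi\<^sub>M L (\<lambda>_. M)) (\<lambda>w. \<lambda>i\<in>L. w i) = Pi\<^sub>M L (\<lambda>_. M)"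
    using assms distr_PiM_reindex[of K "\<lambda>_. M" "\<lambda>i. i" L] by auto
  then have "measure (Pi\<^sub>M L (\<lambda>_. M)) A = measure (distr (Pi\<^sub>M K (\<lambda>_. M)) (Pi\<^sub>M L (\<lambda>_. M)) (\<lambda>w. restrict w L)) A"
    by simp
  also have "\<dots> = measure (Pi\<^sub>M K (\<lambda>_. M)) {w \<in> space (Pi\<^sub>M K (\<lambda>_. M)). restrict w L \<in> A}"
    by (subst measure_distr[OF measurable_restrict_subset[OF \<open>L \<subseteq> K\<close>] A])
      (simp add: vimage_def Int_def conj_commute)
  finally show ?thesis by simp
qed

text \<open>Fubini: given the coordinates in \<open>I\<close>, those in \<open>J\<close> are i.i.d.,
  and the power of the unit distribution function is again a Frechet one. \<open>J\<close> must be
  nonempty: for \<open>u x \<le> 0\<close> an empty condition holds, while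
  \<open>frechet_cdf 0\<close> vanishes.\<close>

lemma prob_all_less:
  assumes M: "prob_space M" and fin: "finite K" and IJ: "I \<subseteq> K" "J \<subseteq> K" "I \<inter> J = {}" "J \<noteq> {}"
    and V: "frechet M 1 V" and u[measurable]: "u \<in> borel_measurable (Pi\<^sub>M I (\<lambda>_. M))"
  shows "measure (Pi\<^sub>M K (\<lambda>_. M)) {w \<in> space (Pi\<^sub>M K (\<lambda>_. M)). \<forall>j\<in>J. V (w j) < u (restrict w I)}
    = (\<integral>x. frechet_cdf (card J) (u x) \<partial>Pi\<^sub>M I (\<lambda>_. M))"
proof -
  interpret prob_space M by fact
  have fI: "finite I" and fJ: "finite J" using fin IJ by (auto intro: finite_subset)
  interpret PI: prob_space "Pi\<^sub>M I (\<lambda>_. M)" by (rule prob_space_PiM) (rule M)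
  interpret PIJ: prob_space "Pi\<^sub>M (I \<union> J) (\<lambda>_. M)" by (rule prob_space_PiM) (rule M)
  interpret J: finite_product_prob_space "\<lambda>_. M" J by unfold_locales fact
  have [measurable]: "V \<in> borel_measurable M" using V by (simp add: frechet_def)
  have J1: "1 \<le> card J" using fJ IJ by (simp add: Suc_le_eq card_gt_0_iff)
  define A where "A = {w \<in> space (Pi\<^sub>M (I \<union> J) (\<lambda>_. M)). \<forall>j\<in>J. V (w j) < u (restrict w I)}"
  have A: "A \<in> sets (Pi\<^sub>M (I \<union> J) (\<lambda>_. M))"
    unfolding A_def using fJ by measurable
  have "measure (Pi\<^sub>M K (\<lambda>_. M)) {w \<in> space (Pi\<^sub>M K (\<lambda>_. M)). \<forall>j\<in>J. V (w j) < u (restrict w I)} =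
     measure (Pi\<^sub>M K (\<lambda>_. M)) {w \<in> space (Pi\<^sub>M K (\<lambda>_. M)). restrict w (I \<union> J) \<in> A}"
    using IJ by (intro arg_cong[where f="measure _"] Collect_cong)
      (auto simp: A_def space_PiM Int_absorb1 restrict_restrict Int_absorb2)
  also have "\<dots> = measure (Pi\<^sub>M (I \<union> J) (\<lambda>_. M)) A"
    using IJ by (intro measure_PiM_restrict M fin A) auto
  also have "\<dots> = (\<integral>x. frechet_cdf (card J) (u x) \<partial>Pi\<^sub>M I (\<lambda>_. M))"
  proof -
    have "emeasure (Pi\<^sub>M (I \<union> J) (\<lambda>_. M)) A =
      (\<integral>\<^sup>+x. emeasure (Pi\<^sub>M J (\<lambda>_. M)) ((\<lambda>y. merge I J (x, y)) -` A \<inter> space (Pi\<^sub>M J (\<lambda>_. M))) \<partial>Pi\<^sub>M I (\<lambda>_. M))"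
      by (rule J.emeasure_fold_integral) (use IJ fI fJ A in auto)
    also have "\<dots> = (\<integral>\<^sup>+x. ennreal (frechet_cdf (card J) (u x)) \<partial>Pi\<^sub>M I (\<lambda>_. M))"
    proof (rule nn_integral_cong)
      fix x assume x: "x \<in> space (Pi\<^sub>M I (\<lambda>_. M))"
      have "(\<lambda>y. merge I J (x, y)) -` A \<inter> space (Pi\<^sub>M J (\<lambda>_. M)) = (\<Pi>\<^sub>E j\<in>J. {\<omega> \<in> space M. V \<omega> < u x})"
      proof (rule set_eqI)
        fix y
        have "restrict (merge I J (x, y)) I = x"
          using x IJ by (simp add: space_PiM PiE_restrict)
        moreover have "merge I J (x, y) j = y j" if "j \<in> J" for j
          using that IJ by (auto simp: merge_def)
        moreover have "merge I J (x, y) \<in> space (Pi\<^sub>M (I \<union> J) (\<lambda>_. M))"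
          if "y \<in> space (Pi\<^sub>M J (\<lambda>_. M))"
          using x that IJ by (simp add: space_PiM PiE_iff) (auto simp: merge_def)
        ultimately show "y \<in> (\<lambda>y. merge I J (x, y)) -` A \<inter> space (Pi\<^sub>M J (\<lambda>_. M)) \<longleftrightarrow>
            y \<in> (\<Pi>\<^sub>E j\<in>J. {\<omega> \<in> space M. V \<omega> < u x})"
          unfolding A_def by (auto simp: space_PiM PiE_iff)
      qed
      then show "emeasure (Pi\<^sub>M J (\<lambda>_. M)) ((\<lambda>y. merge I J (x, y)) -` A \<inter> space (Pi\<^sub>M J (\<lambda>_. M)))
         = ennreal (frechet_cdf (card J) (u x))"
        using J1 by (simp add: J.emeasure_eq_measure J.prob_times frechet_less[OF V] frechet_cdf_power)
    qed
    also have "\<dots> = ennreal (\<integral>x. frechet_cdf (card J) (u x) \<partial>Pi\<^sub>M I (\<lambda>_. M))"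
      by (rule nn_integral_eq_integral)
        (use frechet_cdf_bounds[of "card J"] in \<open>auto intro!: PI.integrable_const_bound[where B=1]\<close>)
    finally show ?thesis
      using frechet_cdf_bounds[of "card J"] by (simp add: PIJ.emeasure_eq_measure)
  qed
  finally show ?thesis .
qed

lemma measure_PiM_component:
  assumes "prob_space M" "i \<in> I" and A: "A \<in> sets M"
  shows "measure (Pi\<^sub>M I (\<lambda>_. M)) {x \<in> space (Pi\<^sub>M I (\<lambda>_. M)). x i \<in> A} = measure M A"
proof -
  have "measure (distr (Pi\<^sub>M I (\<lambda>_. M)) M (\<lambda>x. x i)) A = measure M A"
    using distr_PiM_component[of I "\<lambda>_. M" i] assms by simp
  then show ?thesis
    using assms by (subst (asm) measure_distr) (auto simp: vimage_def Int_def conj_commute)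
qed

lemma frechet_component:
  assumes "prob_space M" "i \<in> I" and V: "frechet M c V"
  shows "frechet (Pi\<^sub>M I (\<lambda>_. M)) c (\<lambda>x. V (x i))"
  unfolding frechet_def
proof (intro conjI allI)
  have [measurable]: "V \<in> borel_measurable M" using V by (simp add: frechet_def)
  show "(\<lambda>x. V (x i)) \<in> borel_measurable (Pi\<^sub>M I (\<lambda>_. M))" using assms(2) by measurable
  fix y
  have "{x \<in> space (Pi\<^sub>M I (\<lambda>_. M)). V (x i) \<le> y} =
      {x \<in> space (Pi\<^sub>M I (\<lambda>_. M)). x i \<in> {\<omega> \<in> space M. V \<omega> \<le> y}}"
    using assms(2) by (auto simp: space_PiM)
  then show "measure (Pi\<^sub>M I (\<lambda>_. M)) {x \<in> space (Pi\<^sub>M I (\<lambda>_. M)). V (x i) \<le> y} = frechet_cdf c y"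
    using V measure_PiM_component[OF assms(1,2), of "{\<omega> \<in> space M. V \<omega> \<le> y}"] by (simp add: frechet_def)
qed

text \<open>Independence multiplies distribution functions, so scales add. With
  \<open>c = d = 1\<close> this yields 2, the coefficient of an independent pair.\<close>

lemma frechet_max_indep:
  assumes M: "prob_space M" and V: "frechet M c V" and W: "frechet M d W" and ab: "a \<noteq> b"
  shows "frechet (Pi\<^sub>M {a, b} (\<lambda>_. M)) (c + d) (\<lambda>x. max (V (x a)) (W (x b)))"
  unfolding frechet_def
proof (intro conjI allI)
  have [measurable]: "V \<in> borel_measurable M" "W \<in> borel_measurable M" using V W by (simp_all add: frechet_def)
  show "(\<lambda>x. max (V (x a)) (W (x b))) \<in> borel_measurable (Pi\<^sub>M {a, b} (\<lambda>_. M))" by measurable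
  interpret prob_space M by fact
  interpret P: finite_product_prob_space "\<lambda>_. M" "{a, b}" by unfold_locales simp
  fix y
  have "{x \<in> space (Pi\<^sub>M {a, b} (\<lambda>_. M)). max (V (x a)) (W (x b)) \<le> y} =
      (\<Pi>\<^sub>E i\<in>{a, b}. if i = a then {\<omega> \<in> space M. V \<omega> \<le> y} else {\<omega> \<in> space M. W \<omega> \<le> y})"
    using ab by (intro set_eqI) (auto simp: space_PiM PiE_iff)
  also have "P.prob \<dots> = frechet_cdf (c + d) y"
    using ab V W by (subst P.prob_times) (auto simp: frechet_def frechet_cdf_mult)
  finally show "P.prob {x \<in> space (Pi\<^sub>M {a, b} (\<lambda>_. M)). max (V (x a)) (W (x b)) \<le> y} = frechet_cdf (c + d) y" .
qed

subsection \<open>Block replacement\<close>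

lemma measure_PiM_transpose:
  assumes M: "prob_space M" and ab: "a \<in> K" "b \<in> K" and P: "Measurable.pred (Pi\<^sub>M K (\<lambda>_. M)) P"
  shows "measure (Pi\<^sub>M K (\<lambda>_. M)) {w \<in> space (Pi\<^sub>M K (\<lambda>_. M)). P (\<lambda>i\<in>K. w (Transposition.transpose a b i))} =
    measure (Pi\<^sub>M K (\<lambda>_. M)) {w \<in> space (Pi\<^sub>M K (\<lambda>_. M)). P w}"
proof -
  let ?N = "Pi\<^sub>M K (\<lambda>_. M)" and ?f = "\<lambda>w. \<lambda>i\<in>K. w (Transposition.transpose a b i)"
  have tr: "Transposition.transpose a b i \<in> K" if "i \<in> K" for i using ab that by (auto simp: Transposition.transpose_def)
  have f: "?f \<in> measurable ?N ?N"
    by (intro measurable_restrict measurable_component_singleton tr)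
  have "distr ?N ?N ?f = ?N"
    using distr_PiM_reindex[of K "\<lambda>_. M" "Transposition.transpose a b" K] M tr by (auto intro: inj_on_subset)
  then have "measure ?N {w \<in> space ?N. P w} = measure (distr ?N ?N ?f) {w \<in> space ?N. P w}" by simp
  also have "\<dots> = measure ?N {w \<in> space ?N. P (?f w)}"
    using P f measurable_space[OF f]
    by (subst measure_distr) (auto simp: pred_def intro!: arg_cong[where f="measure ?N"])
  finally show ?thesis by simp
qed

text \<open>
  Lindeberg replacement of a single coordinate. The part of the increment that is linear in the
  replaced block cancels because the coordinates \<open>a\<close> and \<open>b\<close> are exchangeable; what remains is
  supported on the event that both blocks exceed the remaining maximum \<open>A\<close>.
\<close>

lemma prob_replace_block:
  fixes V :: "'s \<Rightarrow> 'w \<Rightarrow> real" and A :: "'s \<Rightarrow> ('k \<Rightarrow> 'w) \<Rightarrow> real"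
  defines "N K M \<equiv> Pi\<^sub>M (K :: 'k set) (\<lambda>_. M :: 'w measure)"
  assumes M: "prob_space M" and ab: "a \<in> K" "b \<in> K"
    and J: "finite J\<^sub>1" "finite J\<^sub>2" "J\<^sub>1 \<inter> J\<^sub>2 = {}"
    and V: "\<And>s. s \<in> J\<^sub>1 \<union> J\<^sub>2 \<Longrightarrow> V s \<in> borel_measurable M"
    and A: "\<And>s. s \<in> J\<^sub>1 \<union> J\<^sub>2 \<Longrightarrow> A s \<in> borel_measurable (N K M)"
    and A_tr: "\<And>s w. s \<in> J\<^sub>1 \<union> J\<^sub>2 \<Longrightarrow> A s (\<lambda>i\<in>K. w (Transposition.transpose a b i)) = A s w"
    and B: "B \<in> sets (Pi\<^sub>M (J\<^sub>1 \<union> J\<^sub>2) (\<lambda>_. borel))"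
  shows "\<bar>measure (N K M) {w \<in> space (N K M). (\<lambda>s\<in>J\<^sub>1 \<union> J\<^sub>2. max (A s w) (V s (w a))) \<in> B} -
      measure (N K M) {w \<in> space (N K M). (\<lambda>s\<in>J\<^sub>1 \<union> J\<^sub>2. max (A s w) (V s (w (if s \<in> J\<^sub>2 then b else a)))) \<in> B}\<bar>
    \<le> 2 * measure (N K M) {w \<in> space (N K M). \<exists>s\<in>J\<^sub>1. \<exists>t\<in>J\<^sub>2. A s w < V s (w a) \<and> A t w < V t (w a)} +
      2 * measure (N K M) {w \<in> space (N K M). \<exists>s\<in>J\<^sub>1. \<exists>t\<in>J\<^sub>2. A s w < V s (w a) \<and> A t w < V t (w b)}"
    (is "\<bar>measure _ ?Z - measure _ ?Z'\<bar> \<le> 2 * measure _ ?E + 2 * measure _ ?E'")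
proof -
  let ?N = "N K M" and ?T = "J\<^sub>1 \<union> J\<^sub>2"
  interpret N: prob_space ?N unfolding N_def by (rule prob_space_PiM) (rule M)
  have V': "(\<lambda>w. V s (w i)) \<in> borel_measurable ?N" if "s \<in> ?T" "i \<in> K" for s i
    unfolding N_def using measurable_compose[OF measurable_component_singleton[OF that(2)] V[OF that(1)]] .
  have mx: "(\<lambda>w. \<lambda>s\<in>?T. g s w) \<in> measurable ?N (Pi\<^sub>M ?T (\<lambda>_. borel))"
    if "\<And>s. s \<in> ?T \<Longrightarrow> g s \<in> borel_measurable ?N" for g :: "'s \<Rightarrow> ('k \<Rightarrow> 'w) \<Rightarrow> real"
    using that by (intro measurable_restrict)
  \<comment> \<open>The comparison field: the new term enters on the second block only. Swapping
    \<open>a\<close> and \<open>b\<close> fixes \<open>A\<close> and turns \<open>?y b\<close> into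
    \<open>?y a\<close>, so \<open>Y a\<close> and \<open>Y b\<close> have equal probability and
    their difference may be subtracted from the increment.\<close>
  let ?y = "\<lambda>i w. \<lambda>s\<in>?T. if s \<in> J\<^sub>2 then max (A s w) (V s (w i)) else A s w"
  define Y where "Y i = {w \<in> space ?N. ?y i w \<in> B}" for i
  have y: "?y i \<in> measurable ?N (Pi\<^sub>M ?T (\<lambda>_. borel))" if "i \<in> K" for i
  proof (intro mx)
    show "(\<lambda>w. if s \<in> J\<^sub>2 then max (A s w) (V s (w i)) else A s w) \<in> borel_measurable ?N"
      if "s \<in> ?T" for s
      using A[OF that] V'[OF that \<open>i \<in> K\<close>] by (cases "s \<in> J\<^sub>2") simp_all
  qed
  have sets: "?Z \<in> sets ?N" "?Z' \<in> sets ?N" "Y a \<in> sets ?N" "Y b \<in> sets ?N"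
    unfolding Y_def
    by (rule predE[OF pred_sets2[OF B mx]] predE[OF pred_sets2[OF B y]];
        use ab in \<open>auto intro!: borel_measurable_max A V'\<close>)+
  have E: "?E \<in> sets ?N" "?E' \<in> sets ?N"
    by (intro sets.sets_Collect_finite_Ex sets.sets_Collect_conj J predE[OF borel_measurable_pred_less] A V' ab; simp)+
  have "measure ?N (Y a) = measure ?N (Y b)"
  proof -
    have "?y b (\<lambda>i\<in>K. w (Transposition.transpose a b i)) = ?y a w" for w
      using ab A_tr by (auto simp: fun_eq_iff restrict_def)
    moreover have "Measurable.pred ?N (\<lambda>w. ?y b w \<in> B)"
      by (rule pred_sets2[OF B y[OF ab(2)]])
    ultimately show ?thesis
      using measure_PiM_transpose[OF M ab, of "\<lambda>w. ?y b w \<in> B"] unfolding Y_def N_def by simp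
  qed
  then have diff: "measure ?N ?Z - measure ?N ?Z' =
      (\<integral>w. indicator ?Z w - indicator ?Z' w - (indicator (Y a) w - indicator (Y b) w) \<partial>?N)"
    using sets by (simp add: N.emeasure_eq_measure)
  have le: "\<bar>\<integral>w. (indicator ?Z w - indicator ?Z' w - (indicator (Y a) w - indicator (Y b) w) :: real) \<partial>?N\<bar>
      \<le> (\<integral>w. (2 * indicator ?E w + 2 * indicator ?E' w :: real) \<partial>?N)"
  proof (rule order_trans[OF integral_abs_bound integral_mono])
    show "integrable ?N (\<lambda>w. \<bar>indicator ?Z w - indicator ?Z' w - (indicator (Y a) w - indicator (Y b) w) :: real\<bar>)"
      using sets by (auto intro!: integrable_abs Bochner_Integration.integrable_diff simp: N.emeasure_eq_measure)
    show "integrable ?N (\<lambda>w. 2 * indicator ?E w + 2 * indicator ?E' w :: real)"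
      using E by (auto simp: N.emeasure_eq_measure)
    fix w assume w: "w \<in> space ?N"
    show "\<bar>indicator ?Z w - indicator ?Z' w - (indicator (Y a) w - indicator (Y b) w) :: real\<bar>
      \<le> 2 * indicator ?E w + 2 * indicator ?E' w"
    proof (cases "w \<in> ?E \<union> ?E'")
      case True
      then have "indicator ?E w = (1 :: real) \<or> indicator ?E' w = (1 :: real)" by (auto simp: indicator_def)
      then have "1 \<le> (indicator ?E w + indicator ?E' w :: real)" by auto
      moreover have "\<bar>x - y - (p - q)\<bar> \<le> 2" if "x \<in> {0..1}" "y \<in> {0..1}" "p \<in> {0..1}" "q \<in> {0..1}"
        for x y p q :: real using that unfolding abs_le_iff atLeastAtMost_iff by linarith
      then have "\<bar>indicator ?Z w - indicator ?Z' w - (indicator (Y a) w - indicator (Y b) w) :: real\<bar> \<le> 2"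
        by this (simp_all add: indicator_def)
      ultimately show ?thesis by linarith
    next
      case False
      \<comment> \<open>Without exceedance on the first block the original fields coincide with the
        comparison fields, \<open>?Z\<close> with \<open>Y a\<close> and \<open>?Z'\<close> with
        \<open>Y b\<close>. Without exceedance on the second block by either copy, nothing depends
        on the choice between \<open>a\<close> and \<open>b\<close>. In both cases the four
        indicators cancel.\<close>
      then consider "\<forall>s\<in>J\<^sub>1. V s (w a) \<le> A s w" | "\<forall>t\<in>J\<^sub>2. V t (w a) \<le> A t w \<and> V t (w b) \<le> A t w"
        using w by (auto simp: not_less)
      then show ?thesis
      proof cases
        case 1
        then have "(\<lambda>s\<in>?T. max (A s w) (V s (w a))) = ?y a w"
          "(\<lambda>s\<in>?T. max (A s w) (V s (w (if s \<in> J\<^sub>2 then b else a)))) = ?y b w"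
          by (auto simp: fun_eq_iff max_absorb1)
        then show ?thesis using w by (simp add: Y_def indicator_def)
      next
        case 2
        then have "(\<lambda>s\<in>?T. max (A s w) (V s (w a))) = (\<lambda>s\<in>?T. max (A s w) (V s (w (if s \<in> J\<^sub>2 then b else a))))"
          "?y a w = ?y b w"
          by (auto simp: fun_eq_iff max_absorb1)
        then show ?thesis using w by (simp add: Y_def indicator_def)
      qed
    qed
  qed
  have "(\<integral>w. (2 * indicator ?E w + 2 * indicator ?E' w :: real) \<partial>?N) = 2 * measure ?N ?E + 2 * measure ?N ?E'"
    using E by (simp add: N.emeasure_eq_measure)
  with le show ?thesis unfolding diff by (simp only:)
qed

text \<open>The probability that the maximum of \<open>n - 1\<close> i.i.d. unit Frechet variables
  lies below both members of an independent pair of unit Frechet variables whose maximum has scale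
  \<open>c\<close>; here the pair is independent of the \<open>n - 1\<close> variables, not within
  itself.\<close>

definition bound :: "nat \<Rightarrow> real \<Rightarrow> real" where
  "bound n c = 2 / real n - c / (c + (real n - 1))"

text \<open>Separates the replacement argument from max-stability: finitely many unit Frechet
  variables, with a prescribed law only for pair maxima across the two blocks.\<close>

locale frechet_blocks = prob_space M for M :: "'w measure" +
  fixes V :: "'s \<Rightarrow> 'w \<Rightarrow> real" and J\<^sub>1 J\<^sub>2 :: "'s set" and \<theta> :: "'s \<Rightarrow> 's \<Rightarrow> real"
  assumes finite_J: "finite J\<^sub>1" "finite J\<^sub>2" and disjoint_J: "J\<^sub>1 \<inter> J\<^sub>2 = {}"
    and frechet_V: "\<And>s. s \<in> J\<^sub>1 \<union> J\<^sub>2 \<Longrightarrow> frechet M 1 (V s)"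
    and frechet_max: "\<And>s t. s \<in> J\<^sub>1 \<Longrightarrow> t \<in> J\<^sub>2 \<Longrightarrow> frechet M (\<theta> s t) (\<lambda>\<omega>. max (V s \<omega>) (V t \<omega>))"
    and \<theta>_pos: "\<And>s t. s \<in> J\<^sub>1 \<Longrightarrow> t \<in> J\<^sub>2 \<Longrightarrow> 0 < \<theta> s t"
begin

lemma measurable_V: "s \<in> J\<^sub>1 \<union> J\<^sub>2 \<Longrightarrow> V s \<in> borel_measurable M"
  using frechet_V by (simp add: frechet_def)

abbreviation copies :: "nat \<Rightarrow> (nat \<times> bool \<Rightarrow> 'w) measure" where
  "copies n \<equiv> Pi\<^sub>M ({..<n} \<times> UNIV) (\<lambda>_. M)"

text \<open>
  The copies \<open>(i, False)\<close> and \<open>(i, True)\<close> are independent. In \<open>hybrid n k\<close> the second block uses the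
  fresh copy for the indices below \<open>k\<close>, so that \<open>hybrid n n\<close> has independent blocks.
\<close>

definition hybrid :: "nat \<Rightarrow> nat \<Rightarrow> (nat \<times> bool \<Rightarrow> 'w) \<Rightarrow> 's \<Rightarrow> real" where
  "hybrid n k w = (\<lambda>s\<in>J\<^sub>1 \<union> J\<^sub>2. MAX i\<in>{..<n}. V s (w (i, s \<in> J\<^sub>2 \<and> i < k)))"

text \<open>Conditioning on the two copies with index \<open>k\<close> turns the probability into
  the mean of a Frechet distribution function at a minimum. The set \<open>L\<close> is left general
  because the other indices may use either copy; \<open>2 \<le> n\<close> makes it nonempty. With
  the same copy the pair has coefficient \<open>\<theta> s t\<close>, with the fresh one it is
  independent and has coefficient 2.\<close>

lemma prob_exceed:
  assumes s: "s \<in> J\<^sub>1" and t: "t \<in> J\<^sub>2" and u: "u \<in> J\<^sub>1 \<union> J\<^sub>2" and n: "2 \<le> n" and k: "k < n"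
    and L: "L \<subseteq> {..<n} \<times> UNIV - {(k, False), (k, True)}" "card L = n - 1"
  shows "measure (copies n) {w \<in> space (copies n).
        \<forall>j\<in>L. V u (w j) < min (V s (w (k, False))) (V t (w (k, False)))} = bound n (\<theta> s t)" (is ?same)
    and "measure (copies n) {w \<in> space (copies n).
        \<forall>j\<in>L. V u (w j) < min (V s (w (k, False))) (V t (w (k, True)))} = bound n 2" (is ?fresh)
proof -
  let ?I = "{(k, False), (k, True)}"
  interpret PI: prob_space "Pi\<^sub>M ?I (\<lambda>_. M)" by (rule prob_space_PiM) (rule prob_space_axioms)
  have *: "measure (copies n) {w \<in> space (copies n). \<forall>j\<in>L. V u (w j) < min (V s (w a)) (V t (w b))} = bound n c"
    if ab: "a \<in> ?I" "b \<in> ?I" and c: "0 < c"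
      and m: "frechet (Pi\<^sub>M ?I (\<lambda>_. M)) c (\<lambda>x. max (V s (x a)) (V t (x b)))" for a b c
  proof -
    have X: "frechet (Pi\<^sub>M ?I (\<lambda>_. M)) 1 (\<lambda>x. V s (x a))"
      using s by (intro frechet_component prob_space_axioms ab frechet_V) simp
    have Y: "frechet (Pi\<^sub>M ?I (\<lambda>_. M)) 1 (\<lambda>x. V t (x b))"
      using t by (intro frechet_component prob_space_axioms ab frechet_V) simp
    have "measure (copies n) {w \<in> space (copies n). \<forall>j\<in>L. V u (w j) < min (V s (w a)) (V t (w b))} =
        measure (copies n) {w \<in> space (copies n). \<forall>j\<in>L. V u (w j) <
          (\<lambda>x. min (V s (x a)) (V t (x b))) (restrict w ?I)}"
      using ab by (simp only: restrict_apply' if_True)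
    also have "\<dots> = (\<integral>x. frechet_cdf (card L) (min (V s (x a)) (V t (x b))) \<partial>Pi\<^sub>M ?I (\<lambda>_. M))"
    proof (rule prob_all_less)
      show "frechet M 1 (V u)" using u by (rule frechet_V)
      show "(\<lambda>x. min (V s (x a)) (V t (x b))) \<in> borel_measurable (Pi\<^sub>M ?I (\<lambda>_. M))"
        using X Y by (intro borel_measurable_min) (simp_all add: frechet_def)
      show "L \<noteq> {}" using L(2) n by auto
    qed (use k L(1) in \<open>auto intro: prob_space_axioms\<close>)
    also have "\<dots> = bound n c"
      using PI.frechet_min_expectation[OF X Y m c, of "real (card L)"] n
      by (simp add: bound_def L(2) of_nat_diff)
    finally show ?thesis .
  qed
  show ?same
    using frechet_max[OF s t] \<theta>_pos[OF s t]
    by (intro * frechet_component[where V="\<lambda>\<omega>. max (V s \<omega>) (V t \<omega>)"] prob_space_axioms) auto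
  show ?fresh
    using frechet_max_indep[OF prob_space_axioms frechet_V[of s] frechet_V[of t], of "(k, False)" "(k, True)"] s t
    by (intro *) auto
qed

lemma measurable_V_component:
  assumes "s \<in> J\<^sub>1 \<union> J\<^sub>2" "j \<in> {..<n} \<times> UNIV"
  shows "(\<lambda>w. V s (w j)) \<in> borel_measurable (copies n)"
  using measurable_compose[OF measurable_component_singleton[OF assms(2)] measurable_V[OF assms(1)]] .

lemma borel_measurable_hybrid:
  "hybrid n k \<in> measurable (copies n) (Pi\<^sub>M (J\<^sub>1 \<union> J\<^sub>2) (\<lambda>_. borel))"
  unfolding hybrid_def
  by (intro measurable_restrict borel_measurable_Max finite_lessThan measurable_V_component) auto

text \<open>Consecutive hybrids differ only in the index \<open>k\<close>, so splitting off this
  index from the maxima leaves a common remainder \<open>A\<close>. The joint exceedance event is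
  then covered by one event for each pair of points.\<close>

lemma hybrid_step:
  assumes n: "2 \<le> n" and k: "k < n" and B: "B \<in> sets (Pi\<^sub>M (J\<^sub>1 \<union> J\<^sub>2) (\<lambda>_. borel))"
  shows "\<bar>measure (copies n) {w \<in> space (copies n). hybrid n k w \<in> B} -
      measure (copies n) {w \<in> space (copies n). hybrid n (Suc k) w \<in> B}\<bar>
    \<le> (\<Sum>s\<in>J\<^sub>1. \<Sum>t\<in>J\<^sub>2. 4 * bound n (\<theta> s t) + 4 * bound n 2)"
proof -
  let ?N = "copies n" and ?T = "J\<^sub>1 \<union> J\<^sub>2" and ?K = "{..<n} \<times> (UNIV :: bool set)"
  let ?a = "(k, False)" and ?b = "(k, True)"
  interpret N: prob_space ?N by (rule prob_space_PiM) (rule prob_space_axioms)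
  \<comment> \<open>These coordinates avoid both copies with index \<open>k\<close>. Hence
    \<open>A\<close> is independent of the replaced terms, and swapping the two copies leaves it
    unchanged.\<close>
  define L where "L s = (\<lambda>i. (i, s \<in> J\<^sub>2 \<and> i < k)) ` ({..<n} - {k})" for s
  define A where "A s w = (MAX j\<in>L s. V s (w j))" for s w
  have L: "L s \<subseteq> ?K - {?a, ?b}" for s by (auto simp: L_def)
  have fL: "finite (L s)" for s by (simp add: L_def)
  have card_L: "card (L s) = n - 1" for s
    unfolding L_def using k by (subst card_image) (auto simp: inj_on_def)
  have L_ne: "L s \<noteq> {}" for s using card_L[of s] n by auto
  have A_less: "A s w < x \<longleftrightarrow> (\<forall>j\<in>L s. V s (w j) < x)" for s w x
    unfolding A_def using fL L_ne by (subst Max_less_iff) auto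
  note Vw = measurable_V_component[where n=n]
  have A: "A s \<in> borel_measurable ?N" if "s \<in> ?T" for s
    unfolding A_def using L that by (intro borel_measurable_Max fL Vw) auto
  have A_tr: "A s (\<lambda>i\<in>?K. w (Transposition.transpose ?a ?b i)) = A s w" for s w
    unfolding A_def using L[of s]
    by (intro arg_cong[where f=Max] image_cong refl)
      (auto simp: Transposition.transpose_def subset_iff)
  have split: "{..<n} = insert k ({..<n} - {k})" using k by auto
  have ne: "{..<n} - {k} \<noteq> {}" using L_ne[of undefined] by (auto simp: L_def)
  have A_eq: "A s w = (MAX i\<in>{..<n} - {k}. V s (w (i, s \<in> J\<^sub>2 \<and> i < k)))" for s w
    by (simp add: A_def L_def image_image)
  have "(MAX i\<in>{..<n}. V s (w (i, s \<in> J\<^sub>2 \<and> i < k))) = max (A s w) (V s (w ?a))" for s w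
    unfolding A_eq using ne by (subst split, subst image_insert, subst Max_insert) (auto simp: max.commute)
  then have Z: "hybrid n k w = (\<lambda>s\<in>?T. max (A s w) (V s (w ?a)))" for w
    unfolding hybrid_def by simp
  have "(MAX i\<in>{..<n}. V s (w (i, s \<in> J\<^sub>2 \<and> i < Suc k))) =
      max (A s w) (V s (w (if s \<in> J\<^sub>2 then ?b else ?a)))" for s w
  proof -
    have "A s w = (MAX i\<in>{..<n} - {k}. V s (w (i, s \<in> J\<^sub>2 \<and> i < Suc k)))"
      unfolding A_eq by (intro arg_cong[where f=Max] image_cong refl) (auto simp: less_Suc_eq)
    then show ?thesis using ne
      by (subst split, subst image_insert, subst Max_insert) (auto simp: max.commute)
  qed
  then have Z': "hybrid n (Suc k) w = (\<lambda>s\<in>?T. max (A s w) (V s (w (if s \<in> J\<^sub>2 then ?b else ?a))))" for w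
    unfolding hybrid_def by simp
  have union: "measure ?N {w \<in> space ?N. \<exists>s\<in>J\<^sub>1. \<exists>t\<in>J\<^sub>2. A s w < V s (w ?a) \<and> A t w < V t (w b)}
      \<le> (\<Sum>s\<in>J\<^sub>1. \<Sum>t\<in>J\<^sub>2. 2 * c s t)"
    if b: "b \<in> ?K" and c: "\<And>s t u. s \<in> J\<^sub>1 \<Longrightarrow> t \<in> J\<^sub>2 \<Longrightarrow> u \<in> ?T \<Longrightarrow>
      measure ?N {w \<in> space ?N. A u w < min (V s (w ?a)) (V t (w b))} = c s t" for b c
  proof -
    let ?E = "\<lambda>s t. {w \<in> space ?N. A s w < V s (w ?a) \<and> A t w < V t (w b)}"
    have a: "?a \<in> ?K" using k by simp
    have E: "?E s t \<in> sets ?N" if "s \<in> J\<^sub>1" "t \<in> J\<^sub>2" for s t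
      using that by (intro sets.sets_Collect_conj predE[OF borel_measurable_pred_less] A Vw a b) auto
    have F: "{w \<in> space ?N. A u w < min (V s (w ?a)) (V t (w b))} \<in> sets ?N"
      if "s \<in> J\<^sub>1" "t \<in> J\<^sub>2" "u \<in> ?T" for s t u
      using that by (intro predE[OF borel_measurable_pred_less] borel_measurable_min A Vw a b) auto
    have "{w \<in> space ?N. \<exists>s\<in>J\<^sub>1. \<exists>t\<in>J\<^sub>2. A s w < V s (w ?a) \<and> A t w < V t (w b)} =
        (\<Union>s\<in>J\<^sub>1. \<Union>t\<in>J\<^sub>2. ?E s t)" by auto
    also have "measure ?N \<dots> \<le> (\<Sum>s\<in>J\<^sub>1. measure ?N (\<Union>t\<in>J\<^sub>2. ?E s t))"
      by (intro measure_UNION_le finite_J sets.finite_UN E)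
    also have "\<dots> \<le> (\<Sum>s\<in>J\<^sub>1. \<Sum>t\<in>J\<^sub>2. measure ?N (?E s t))"
      by (intro sum_mono measure_UNION_le finite_J E)
    also have "\<dots> \<le> (\<Sum>s\<in>J\<^sub>1. \<Sum>t\<in>J\<^sub>2. 2 * c s t)"
    proof (intro sum_mono)
      fix s t assume st: "s \<in> J\<^sub>1" "t \<in> J\<^sub>2"
      \<comment> \<open>Split according to which of \<open>A s w\<close> and \<open>A t w\<close> is
        the smaller: that one lies below both new terms.\<close>
      have "measure ?N (?E s t) \<le> measure ?N
          ({w \<in> space ?N. A s w < min (V s (w ?a)) (V t (w b))} \<union>
           {w \<in> space ?N. A t w < min (V s (w ?a)) (V t (w b))})"
        using st by (intro N.finite_measure_mono sets.Un F) auto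
      also have "\<dots> \<le> c s t + c s t"
        using st c[OF st, of s] c[OF st, of t]
        by (intro order_trans[OF measure_Un_le] F) (auto simp del: min_less_iff_conj)
      finally show "measure ?N (?E s t) \<le> 2 * c s t" by simp
    qed
    finally show ?thesis .
  qed
  have "\<bar>measure ?N {w \<in> space ?N. hybrid n k w \<in> B} - measure ?N {w \<in> space ?N. hybrid n (Suc k) w \<in> B}\<bar>
     \<le> 2 * measure ?N {w \<in> space ?N. \<exists>s\<in>J\<^sub>1. \<exists>t\<in>J\<^sub>2. A s w < V s (w ?a) \<and> A t w < V t (w ?a)} +
      2 * measure ?N {w \<in> space ?N. \<exists>s\<in>J\<^sub>1. \<exists>t\<in>J\<^sub>2. A s w < V s (w ?a) \<and> A t w < V t (w ?b)}"
    unfolding Z Z'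
    by (rule prob_replace_block[OF prob_space_axioms _ _ finite_J disjoint_J measurable_V A A_tr B])
      (use k in auto)
  also have "\<dots> \<le> 2 * (\<Sum>s\<in>J\<^sub>1. \<Sum>t\<in>J\<^sub>2. 2 * bound n (\<theta> s t)) + 2 * (\<Sum>s\<in>J\<^sub>1. \<Sum>t\<in>J\<^sub>2. 2 * bound n 2)"
    using k prob_exceed[OF _ _ _ n k L card_L]
    by (intro add_mono mult_left_mono union) (simp_all only: A_less, auto)
  also have "\<dots> = (\<Sum>s\<in>J\<^sub>1. \<Sum>t\<in>J\<^sub>2. 4 * bound n (\<theta> s t) + 4 * bound n 2)"
    by (simp add: sum_distrib_left sum.distrib mult.assoc[symmetric])
  finally show ?thesis .
qed

lemma hybrid_total:
  assumes n: "2 \<le> n" and B: "B \<in> sets (Pi\<^sub>M (J\<^sub>1 \<union> J\<^sub>2) (\<lambda>_. borel))"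
  shows "\<bar>measure (copies n) {w \<in> space (copies n). hybrid n 0 w \<in> B} -
      measure (copies n) {w \<in> space (copies n). hybrid n n w \<in> B}\<bar>
    \<le> (\<Sum>s\<in>J\<^sub>1. \<Sum>t\<in>J\<^sub>2. 4 * (n * bound n (\<theta> s t)) + 4 * (n * bound n 2))"
proof -
  let ?P = "\<lambda>k. measure (copies n) {w \<in> space (copies n). hybrid n k w \<in> B}"
  have tel: "(\<Sum>k<n. ?P (Suc k) - ?P k) = ?P n - ?P 0" by (rule sum_lessThan_telescope)
  have "\<bar>?P 0 - ?P n\<bar> = \<bar>\<Sum>k<n. ?P (Suc k) - ?P k\<bar>"
    unfolding tel by (rule abs_minus_commute)
  also have "\<dots> \<le> (\<Sum>k<n. \<bar>?P (Suc k) - ?P k\<bar>)" by (rule sum_abs)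
  also have "\<dots> \<le> (\<Sum>k<n. \<Sum>s\<in>J\<^sub>1. \<Sum>t\<in>J\<^sub>2. 4 * bound n (\<theta> s t) + 4 * bound n 2)"
    using hybrid_step[OF n _ B] by (intro sum_mono) (simp add: abs_minus_commute)
  also have "\<dots> = (\<Sum>s\<in>J\<^sub>1. \<Sum>t\<in>J\<^sub>2. 4 * (n * bound n (\<theta> s t)) + 4 * (n * bound n 2))"
    by (simp add: sum_distrib_left algebra_simps)
  finally show ?thesis .
qed

text \<open>For \<open>n > 0\<close> the term equals \<open>2 - c / (1 + (c - 1) / n)\<close>. At
  \<open>c = 2\<close> the limit is 0, so exceedances involving the fresh copy cost nothing
  asymptotically.\<close>

lemma tendsto_bound:
  assumes "0 < c"
  shows "(\<lambda>n. real n * bound n c) \<longlonglongrightarrow> 2 - c"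
proof -
  have inv: "(\<lambda>n. (c - 1) / real n) \<longlonglongrightarrow> 0"
    by (rule tendsto_divide_0[OF tendsto_const filterlim_at_top_imp_at_infinity[OF filterlim_real_sequentially]])
  have "(\<lambda>n. 2 - c / (1 + (c - 1) / real n)) \<longlonglongrightarrow> 2 - c / (1 + 0)"
    by (intro tendsto_intros inv) simp
  moreover have "\<forall>\<^sub>F n in sequentially. 2 - c / (1 + (c - 1) / real n) = real n * bound n c"
    using eventually_gt_at_top[of 0]
  proof eventually_elim
    case (elim n)
    then have "c / (1 + (c - 1) / real n) = real n * (c / (c + (real n - 1)))"
      by (simp add: divide_simps)
    then show ?case using elim by (simp add: bound_def right_diff_distrib)
  qed
  ultimately show ?thesis by (simp add: tendsto_cong)
qed

end

subsection \<open>Max-stable fields on finitely many points\<close>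

text \<open>Max-stability is applied to two independent samples, whereas replacement runs in one
  sample indexed by pairs. This identifies the two; it suffices to compare the measures on
  rectangles, whose preimages are products of two rectangles.\<close>

lemma distr_PiM_pair_bool:
  fixes I :: "'i set" and M :: "'w measure"
  assumes M: "prob_space M" and I: "finite I"
  defines "P \<equiv> Pi\<^sub>M I (\<lambda>_. M)" and "N \<equiv> Pi\<^sub>M (I \<times> (UNIV :: bool set)) (\<lambda>_. M)"
  shows "(\<lambda>(x, y). \<lambda>j\<in>I \<times> UNIV. if snd j then y (fst j) else x (fst j)) \<in> measurable (P \<Otimes>\<^sub>M P) N" (is "?f \<in> _")
    and "distr (P \<Otimes>\<^sub>M P) N (\<lambda>(x, y). \<lambda>j\<in>I \<times> UNIV. if snd j then y (fst j) else x (fst j)) = N"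
proof -
  interpret P: finite_product_prob_space "\<lambda>_. M" I
    using I M by (simp add: finite_product_prob_space_def product_prob_space_def product_sigma_finite_def
      finite_product_sigma_finite_def finite_product_sigma_finite_axioms_def product_prob_space_axioms_def
      prob_space_imp_sigma_finite)
  interpret P': prob_space P unfolding P_def by (rule prob_space_PiM) (rule M)
  interpret PP: pair_prob_space P P ..
  show f: "?f \<in> measurable (P \<Otimes>\<^sub>M P) N"
    unfolding split_beta' N_def
  proof (rule measurable_restrict)
    fix j :: "'i \<times> bool" assume j: "j \<in> I \<times> UNIV"
    then have "(\<lambda>p. fst p (fst j)) \<in> measurable (P \<Otimes>\<^sub>M P) M" "(\<lambda>p. snd p (fst j)) \<in> measurable (P \<Otimes>\<^sub>M P) M"
      unfolding P_def by (auto intro!: measurable_compose[OF measurable_fst] measurable_compose[OF measurable_snd])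
    then show "(\<lambda>p. if snd j then snd p (fst j) else fst p (fst j)) \<in> measurable (P \<Otimes>\<^sub>M P) M" by simp
  qed
  show "distr (P \<Otimes>\<^sub>M P) N ?f = N"
    unfolding N_def
  proof (rule product_sigma_finite.PiM_eqI)
    show "product_sigma_finite (\<lambda>_ :: 'i \<times> bool. M)"
      using M by (simp add: product_sigma_finite_def prob_space_imp_sigma_finite)
    show "finite (I \<times> (UNIV :: bool set))" using I by simp
    fix A :: "'i \<times> bool \<Rightarrow> 'w set" assume A: "\<And>j. j \<in> I \<times> UNIV \<Longrightarrow> A j \<in> sets M"
    have A_sets: "Pi\<^sub>E (I \<times> UNIV) A \<in> sets N" unfolding N_def using A I by (intro sets_PiM_I_finite) auto
    have pre: "?f -` Pi\<^sub>E (I \<times> UNIV) A \<inter> space (P \<Otimes>\<^sub>M P) =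
        (\<Pi>\<^sub>E i\<in>I. A (i, False)) \<times> (\<Pi>\<^sub>E i\<in>I. A (i, True))" (is "?l = ?r")
    proof (rule set_eqI)
      fix p :: "('i \<Rightarrow> 'w) \<times> ('i \<Rightarrow> 'w)"
      obtain x y where p: "p = (x, y)" by (cases p)
      have A_sub: "A (i, b) \<subseteq> space M" if "i \<in> I" for i b using A[of "(i, b)"] that sets.sets_into_space by blast
      have "?f p \<in> Pi\<^sub>E (I \<times> UNIV) A \<longleftrightarrow> (\<forall>i\<in>I. x i \<in> A (i, False) \<and> y i \<in> A (i, True))"
        unfolding p by (force simp: PiE_iff)
      moreover have "x i \<in> space M" if "x i \<in> A (i, False)" "i \<in> I" for i using A_sub that by blast
      moreover have "y i \<in> space M" if "y i \<in> A (i, True)" "i \<in> I" for i using A_sub that by blast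
      ultimately show "p \<in> ?l \<longleftrightarrow> p \<in> ?r"
        unfolding p P_def by (auto simp: space_pair_measure space_PiM PiE_iff)
    qed
    have sets: "(\<Pi>\<^sub>E i\<in>I. A (i, b)) \<in> sets P" for b
      unfolding P_def using A I by (intro sets_PiM_I_finite) auto
    have "emeasure (distr (P \<Otimes>\<^sub>M P) N ?f) (Pi\<^sub>E (I \<times> UNIV) A) =
        emeasure P (\<Pi>\<^sub>E i\<in>I. A (i, False)) * emeasure P (\<Pi>\<^sub>E i\<in>I. A (i, True))"
      by (simp add: emeasure_distr[OF f A_sets] pre P'.emeasure_pair_measure_Times sets)
    also have "\<dots> = (\<Prod>i\<in>I. emeasure M (A (i, False))) * (\<Prod>i\<in>I. emeasure M (A (i, True)))"
      unfolding P_def using A by (simp add: P.emeasure_PiM[OF I])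
    also have "\<dots> = (\<Prod>j\<in>I \<times> UNIV. emeasure M (A j))"
      by (simp add: prod.cartesian_product' UNIV_bool prod.distrib mult.commute split: prod.splits)
    finally show "emeasure (distr (P \<Otimes>\<^sub>M P) (Pi\<^sub>M (I \<times> UNIV) (\<lambda>_. M)) ?f) (Pi\<^sub>E (I \<times> UNIV) A) =
        (\<Prod>j\<in>I \<times> UNIV. emeasure M (A j))"
      unfolding N_def .
  qed simp
qed

text \<open>The law of an independent pair is the product of its marginal laws, so max-stability
  passes to two independent copies of the field.\<close>

lemma max_stable_pair_measure:
  fixes \<eta> :: "'a::metric_space \<Rightarrow> 'w \<Rightarrow> real"
  assumes ms: "simple_max_stable M \<eta>" and n: "1 \<le> n"
    and C: "C \<in> sets (Pi\<^sub>M UNIV (\<lambda>_. borel) \<Otimes>\<^sub>M Pi\<^sub>M UNIV (\<lambda>_. borel))"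
  defines "P \<equiv> Pi\<^sub>M {..<n} (\<lambda>_. M)"
  shows "measure (P \<Otimes>\<^sub>M P) {p \<in> space (P \<Otimes>\<^sub>M P).
      (\<lambda>t. MAX i\<in>{..<n}. \<eta> t (fst p i), \<lambda>t. MAX i\<in>{..<n}. \<eta> t (snd p i)) \<in> C} =
    measure (M \<Otimes>\<^sub>M M) {p \<in> space (M \<Otimes>\<^sub>M M).
      (\<lambda>t. real n * \<eta> t (fst p), \<lambda>t. real n * \<eta> t (snd p)) \<in> C}"
proof -
  note [measurable] = simple_max_stableD(2)[OF ms]
  interpret prob_space M using ms by (rule simple_max_stableD)
  interpret P: prob_space P unfolding P_def by (rule prob_space_PiM) (rule prob_space_axioms)
  let ?R = "Pi\<^sub>M UNIV (\<lambda>_. borel) :: ('a \<Rightarrow> real) measure"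
  let ?f = "\<lambda>w t. MAX i\<in>{..<n}. \<eta> t (w i)" and ?g = "\<lambda>\<omega> t. real n * \<eta> t \<omega>"
  have f: "?f \<in> measurable P ?R"
    unfolding P_def by (rule measurable_PiM_single') (auto intro!: borel_measurable_Max)
  have g: "?g \<in> measurable M ?R"
    by (rule measurable_PiM_single') auto
  have eq: "distr P ?R ?f = distr M ?R ?g"
    using ms n by (simp add: simple_max_stable_def P_def)
  have "distr (P \<Otimes>\<^sub>M P) (?R \<Otimes>\<^sub>M ?R) (\<lambda>(x, y). (?f x, ?f y)) = distr P ?R ?f \<Otimes>\<^sub>M distr P ?R ?f"
    by (rule pair_measure_distr[OF f f, symmetric])
      (intro prob_space_imp_sigma_finite P.prob_space_distr f)
  also have "\<dots> = distr (M \<Otimes>\<^sub>M M) (?R \<Otimes>\<^sub>M ?R) (\<lambda>(x, y). (?g x, ?g y))"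
    unfolding eq by (rule pair_measure_distr[OF g g])
      (intro prob_space_imp_sigma_finite prob_space_distr g)
  finally have "measure (distr (P \<Otimes>\<^sub>M P) (?R \<Otimes>\<^sub>M ?R) (\<lambda>(x, y). (?f x, ?f y))) C =
      measure (distr (M \<Otimes>\<^sub>M M) (?R \<Otimes>\<^sub>M ?R) (\<lambda>(x, y). (?g x, ?g y))) C" by simp
  moreover have "(\<lambda>(x, y). (?f x, ?f y)) \<in> measurable (P \<Otimes>\<^sub>M P) (?R \<Otimes>\<^sub>M ?R)"
    unfolding split_beta'
    by (intro measurable_Pair measurable_compose[OF measurable_fst f] measurable_compose[OF measurable_snd f])
  moreover have "(\<lambda>(x, y). (?g x, ?g y)) \<in> measurable (M \<Otimes>\<^sub>M M) (?R \<Otimes>\<^sub>M ?R)"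
    unfolding split_beta'
    by (intro measurable_Pair measurable_compose[OF measurable_fst g] measurable_compose[OF measurable_snd g])
  ultimately show ?thesis
    using C by (simp add: measure_distr vimage_def Int_def conj_commute split_beta')
qed

lemma max_stable_frechet:
  assumes ms: "simple_max_stable M \<eta>"
  shows "frechet M 1 (\<eta> t)"
    and "frechet M (extremal_coeff M \<eta> s t) (\<lambda>\<omega>. max (\<eta> s \<omega>) (\<eta> t \<omega>))"
proof -
  note [measurable] = simple_max_stableD(2)[OF ms]
  interpret prob_space M using ms by (rule simple_max_stableD)
  show "frechet M 1 (\<eta> t)"
    using ms by (simp add: frechet_def frechet_cdf_def simple_max_stable_def continuous_random_field_def)
  have "prob {\<omega> \<in> space M. max (\<eta> s \<omega>) (\<eta> t \<omega>) \<le> y} = 0" if "y \<le> 0" for y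
  proof -
    have "prob {\<omega> \<in> space M. max (\<eta> s \<omega>) (\<eta> t \<omega>) \<le> y} \<le> prob {\<omega> \<in> space M. \<eta> t \<omega> \<le> 0}"
      using that by (intro finite_measure_mono) auto
    then show ?thesis using simple_max_stableD(5)[OF ms, of t] by (simp add: measure_le_0_iff)
  qed
  then show "frechet M (extremal_coeff M \<eta> s t) (\<lambda>\<omega>. max (\<eta> s \<omega>) (\<eta> t \<omega>))"
    using max_stable_extremal_coeff(1)[OF ms] by (simp add: frechet_def frechet_cdf_def not_less)
qed

text \<open>For every \<open>n\<close> both probabilities are those of the end points
  \<open>hybrid n 0\<close> and \<open>hybrid n n\<close> of the chain, for an event rescaled by
  \<open>n\<close>. The left-hand side is free of \<open>n\<close>, so the bound may be taken to its
  limit.\<close>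

lemma max_stable_mixing_finite:
  fixes \<eta> :: "'a::metric_space \<Rightarrow> 'w \<Rightarrow> real"
  assumes ms: "simple_max_stable M \<eta>" and J: "finite J\<^sub>1" "finite J\<^sub>2" "J\<^sub>1 \<inter> J\<^sub>2 = {}"
    and B: "B \<in> sets (Pi\<^sub>M (J\<^sub>1 \<union> J\<^sub>2) (\<lambda>_. borel))"
  shows "\<bar>measure M {\<omega> \<in> space M. (\<lambda>s\<in>J\<^sub>1 \<union> J\<^sub>2. \<eta> s \<omega>) \<in> B} -
      measure (M \<Otimes>\<^sub>M M) {p \<in> space (M \<Otimes>\<^sub>M M).
        (\<lambda>s\<in>J\<^sub>1 \<union> J\<^sub>2. if s \<in> J\<^sub>2 then \<eta> s (snd p) else \<eta> s (fst p)) \<in> B}\<bar>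
    \<le> (\<Sum>s\<in>J\<^sub>1. \<Sum>t\<in>J\<^sub>2. 4 * (2 - extremal_coeff M \<eta> s t))"
    (is "?lhs \<le> _")
proof -
  let ?T = "J\<^sub>1 \<union> J\<^sub>2" and ?\<theta> = "extremal_coeff M \<eta>"
  let ?R = "Pi\<^sub>M UNIV (\<lambda>_. borel) :: ('a \<Rightarrow> real) measure"
  note [measurable] = simple_max_stableD(2)[OF ms]
  interpret prob_space M using ms by (rule simple_max_stableD)
  interpret frechet_blocks M \<eta> J\<^sub>1 J\<^sub>2 ?\<theta>
    by unfold_locales (use J max_stable_frechet[OF ms] max_stable_extremal_coeff(2)[OF ms] in auto)
  have bound: "?lhs \<le> (\<Sum>s\<in>J\<^sub>1. \<Sum>t\<in>J\<^sub>2. 4 * (n * bound n (?\<theta> s t)) + 4 * (n * bound n 2))" if n: "2 \<le> n" for n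
  proof -
    let ?P = "Pi\<^sub>M {..<n} (\<lambda>_. M)"
    let ?\<Phi> = "\<lambda>(x, y). \<lambda>j\<in>{..<n} \<times> UNIV. if snd j then y (fst j) else x (fst j)"
    have n0: "1 \<le> n" using n by simp
    \<comment> \<open>The maximum of \<open>n\<close> copies has the law of \<open>n\<close> times
      the field, so the event has to be dilated by \<open>n\<close>.\<close>
    define B' where "B' = {f \<in> space (Pi\<^sub>M ?T (\<lambda>_. borel)). (\<lambda>s\<in>?T. f s / real n) \<in> B}"
    have B': "B' \<in> sets (Pi\<^sub>M ?T (\<lambda>_. borel))"
      unfolding B'_def
      by (rule predE[OF pred_sets2[OF B measurable_restrict]])
        (intro borel_measurable_divide measurable_component_singleton borel_measurable_const)
    \<comment> \<open>\<open>D\<close> collects the points read from the second sample. The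
      condition that it be the same for all indices holds at both ends of the chain:
      \<open>k = 0\<close> with \<open>D\<close> empty, and \<open>k = n\<close> with
      \<open>D = J\<^sub>2\<close>.\<close>
    have hyb: "measure (copies n) {w \<in> space (copies n). hybrid n k w \<in> B'} =
      measure (M \<Otimes>\<^sub>M M) {p \<in> space (M \<Otimes>\<^sub>M M). (\<lambda>s\<in>?T. if s \<in> D then \<eta> s (snd p) else \<eta> s (fst p)) \<in> B}"
      if D: "\<And>i s. i < n \<Longrightarrow> (s \<in> J\<^sub>2 \<and> i < k) \<longleftrightarrow> s \<in> D" for k D
    proof -
      define C where "C = {q \<in> space (?R \<Otimes>\<^sub>M ?R). (\<lambda>s\<in>?T. if s \<in> D then snd q s else fst q s) \<in> B'}"
      have meas: "(\<lambda>q. \<lambda>s\<in>?T. if s \<in> D then snd q s else fst q s) \<in>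
          measurable (?R \<Otimes>\<^sub>M ?R) (Pi\<^sub>M ?T (\<lambda>_. borel))"
      proof (rule measurable_restrict)
        fix s
        have "(\<lambda>q. snd q s) \<in> borel_measurable (?R \<Otimes>\<^sub>M ?R)" "(\<lambda>q. fst q s) \<in> borel_measurable (?R \<Otimes>\<^sub>M ?R)"
          by measurable
        then show "(\<lambda>q. if s \<in> D then snd q s else fst q s) \<in> borel_measurable (?R \<Otimes>\<^sub>M ?R)" by simp
      qed
      have C: "C \<in> sets (?R \<Otimes>\<^sub>M ?R)"
        unfolding C_def by (rule predE[OF pred_sets2[OF B' meas]])
      note \<Phi> = distr_PiM_pair_bool[OF prob_space_axioms finite_lessThan, of n]
      have H: "{w \<in> space (copies n). hybrid n k w \<in> B'} \<in> sets (copies n)"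
        by (rule predE[OF pred_sets2[OF B' borel_measurable_hybrid]])
      have "measure (copies n) {w \<in> space (copies n). hybrid n k w \<in> B'} =
          measure (distr (?P \<Otimes>\<^sub>M ?P) (copies n) ?\<Phi>) {w \<in> space (copies n). hybrid n k w \<in> B'}"
        unfolding \<Phi>(2) ..
      also have "\<dots> = measure (?P \<Otimes>\<^sub>M ?P) {p \<in> space (?P \<Otimes>\<^sub>M ?P). hybrid n k (?\<Phi> p) \<in> B'}"
        unfolding measure_distr[OF \<Phi>(1) H]
        using measurable_space[OF \<Phi>(1)] by (intro arg_cong[where f="measure _"]) blast
      also have "\<dots> = measure (?P \<Otimes>\<^sub>M ?P) {p \<in> space (?P \<Otimes>\<^sub>M ?P).
          (\<lambda>t. MAX i\<in>{..<n}. \<eta> t (fst p i), \<lambda>t. MAX i\<in>{..<n}. \<eta> t (snd p i)) \<in> C}"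
      proof -
        have "hybrid n k (?\<Phi> p) = (\<lambda>s\<in>?T. if s \<in> D then MAX i\<in>{..<n}. \<eta> s (snd p i) else MAX i\<in>{..<n}. \<eta> s (fst p i))" for p
          unfolding hybrid_def
          by (intro restrict_ext, cases p) (auto simp: D intro!: arg_cong[where f=Max] image_cong)
        then show ?thesis by (simp add: C_def space_pair_measure space_PiM cong: if_cong)
      qed
      also have "\<dots> = measure (M \<Otimes>\<^sub>M M) {p \<in> space (M \<Otimes>\<^sub>M M).
          (\<lambda>t. real n * \<eta> t (fst p), \<lambda>t. real n * \<eta> t (snd p)) \<in> C}"
        by (rule max_stable_pair_measure[OF ms n0 C])
      also have "\<dots> = measure (M \<Otimes>\<^sub>M M) {p \<in> space (M \<Otimes>\<^sub>M M). (\<lambda>s\<in>?T. if s \<in> D then \<eta> s (snd p) else \<eta> s (fst p)) \<in> B}"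
      proof -
        have "(\<lambda>s\<in>?T. (\<lambda>s\<in>?T. if s \<in> D then real n * \<eta> s (snd p) else real n * \<eta> s (fst p)) s / real n) =
           (\<lambda>s\<in>?T. if s \<in> D then \<eta> s (snd p) else \<eta> s (fst p))" for p
          using n by (intro restrict_ext) auto
        then show ?thesis by (simp add: C_def B'_def space_pair_measure space_PiM cong: if_cong)
      qed
      finally show ?thesis .
    qed
    have "measure (copies n) {w \<in> space (copies n). hybrid n 0 w \<in> B'} =
      measure (M \<Otimes>\<^sub>M M) {p \<in> space (M \<Otimes>\<^sub>M M). (\<lambda>s\<in>?T. \<eta> s (fst p)) \<in> B}"
      using hyb[of 0 "{}"] by simp
    also have "{p \<in> space (M \<Otimes>\<^sub>M M). (\<lambda>s\<in>?T. \<eta> s (fst p)) \<in> B} = {\<omega> \<in> space M. (\<lambda>s\<in>?T. \<eta> s \<omega>) \<in> B} \<times> space M"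
      by (auto simp: space_pair_measure)
    also have "measure (M \<Otimes>\<^sub>M M) \<dots> = prob {\<omega> \<in> space M. (\<lambda>s\<in>?T. \<eta> s \<omega>) \<in> B}"
    proof -
      have "{\<omega> \<in> space M. (\<lambda>s\<in>?T. \<eta> s \<omega>) \<in> B} \<in> sets M"
        by (rule predE[OF pred_sets2[OF B measurable_restrict]]) simp
      then show ?thesis
        by (simp add: measure_def emeasure_pair_measure_Times emeasure_space_1)
    qed
    finally show ?thesis
      using hybrid_total[OF n B'] hyb[of n J\<^sub>2] by simp
  qed
  have "(\<lambda>n. \<Sum>s\<in>J\<^sub>1. \<Sum>t\<in>J\<^sub>2. 4 * (real n * bound n (?\<theta> s t)) + 4 * (real n * bound n 2))
      \<longlonglongrightarrow> (\<Sum>s\<in>J\<^sub>1. \<Sum>t\<in>J\<^sub>2. 4 * (2 - ?\<theta> s t) + 4 * (2 - 2))"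
    by (intro tendsto_intros tendsto_bound max_stable_extremal_coeff(2)[OF ms]) simp
  moreover have "\<forall>\<^sub>F n in sequentially.
      ?lhs \<le> (\<Sum>s\<in>J\<^sub>1. \<Sum>t\<in>J\<^sub>2. 4 * (real n * bound n (?\<theta> s t)) + 4 * (real n * bound n 2))"
    using eventually_ge_at_top[of 2] by eventually_elim (rule bound)
  ultimately have "?lhs \<le> (\<Sum>s\<in>J\<^sub>1. \<Sum>t\<in>J\<^sub>2. 4 * (2 - ?\<theta> s t) + 4 * (2 - 2))"
    by (intro tendsto_lowerbound) auto
  then show ?thesis by simp
qed

subsection \<open>Countable sets\<close>

lemma measurable_cont_borel:
  assumes "countable S" and "\<And>x. x \<in> space N \<Longrightarrow> f x \<in> cont_funs S"
    and "\<And>s. s \<in> S \<Longrightarrow> (\<lambda>x. f x s) \<in> borel_measurable N"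
  shows "f \<in> measurable N (cont_borel S)"
proof -
  have "f \<in> measurable N (restrict_space (Pi\<^sub>M S (\<lambda>_. borel)) (cont_funs S))"
    using assms by (intro measurable_restrict_space2 measurable_PiM_single')
      (auto simp: cont_funs_def PiE_def)
  then show ?thesis
    by (simp only: measurable_cong_sets[OF refl sets_cont_borel_countable[OF assms(1)]])
qed

lemma merge_cont_funs:
  assumes S: "closed S\<^sub>1" "closed S\<^sub>2" "S\<^sub>1 \<inter> S\<^sub>2 = {}" and "f \<in> cont_funs S\<^sub>1" "g \<in> cont_funs S\<^sub>2"
  shows "merge S\<^sub>1 S\<^sub>2 (f, g) \<in> cont_funs (S\<^sub>1 \<union> S\<^sub>2)"
proof -
  have "continuous_on S\<^sub>1 (merge S\<^sub>1 S\<^sub>2 (f, g)) \<longleftrightarrow> continuous_on S\<^sub>1 f"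
    by (rule continuous_on_cong) (auto simp: merge_def)
  moreover have "continuous_on S\<^sub>2 (merge S\<^sub>1 S\<^sub>2 (f, g)) \<longleftrightarrow> continuous_on S\<^sub>2 g"
    using S(3) by (intro continuous_on_cong) (auto simp: merge_def)
  ultimately show ?thesis
    using assms by (auto simp: cont_funs_def intro: continuous_on_closed_Un)
qed

lemma nonneg_sum_le_infsum_ereal:
  fixes f :: "'i \<Rightarrow> ereal"
  assumes "\<And>x. x \<in> A \<Longrightarrow> 0 \<le> f x" "finite F" "F \<subseteq> A"
  shows "sum f F \<le> infsum f A"
proof -
  have "infsum f A = (SUP F\<in>{F. finite F \<and> F \<subseteq> A}. sum f F)"
    using assms(1) by (rule nonneg_infsum_complete)
  then show ?thesis using assms(2,3) by (auto intro: SUP_upper)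
qed

context
  fixes M :: "'w measure" and \<eta> :: "'a::metric_space \<Rightarrow> 'w \<Rightarrow> real"
  assumes ms: "simple_max_stable M \<eta>"
begin

lemma measurable_law_on:
  assumes "countable S"
  shows "(\<lambda>\<omega>. restrict (\<lambda>t. \<eta> t \<omega>) S) \<in> measurable M (cont_borel S)"
  using simple_max_stableD(2,3)[OF ms] by (intro measurable_cont_borel assms) (auto simp: cont_funs_def)

text \<open>Realises the product law by a single field on \<open>M \<Otimes>\<^sub>M M\<close> that
  reads its two blocks from two independent sample points, the form treated in the finite
  case.\<close>

lemma law_on_product:
  assumes S: "closed S\<^sub>1" "closed S\<^sub>2" "S\<^sub>1 \<inter> S\<^sub>2 = {}" "countable S\<^sub>1" "countable S\<^sub>2"
  shows "distr (law_on M \<eta> S\<^sub>1 \<Otimes>\<^sub>M law_on M \<eta> S\<^sub>2) (cont_borel (S\<^sub>1 \<union> S\<^sub>2)) (merge S\<^sub>1 S\<^sub>2) =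
    distr (M \<Otimes>\<^sub>M M) (cont_borel (S\<^sub>1 \<union> S\<^sub>2)) (\<lambda>p. \<lambda>s\<in>S\<^sub>1 \<union> S\<^sub>2. if s \<in> S\<^sub>2 then \<eta> s (snd p) else \<eta> s (fst p))"
proof -
  interpret prob_space M using ms by (rule simple_max_stableD)
  let ?r = "\<lambda>S \<omega>. restrict (\<lambda>t. \<eta> t \<omega>) S"
  note m1 = measurable_law_on[OF S(4)] and m2 = measurable_law_on[OF S(5)]
  have pair: "law_on M \<eta> S\<^sub>1 \<Otimes>\<^sub>M law_on M \<eta> S\<^sub>2 =
      distr (M \<Otimes>\<^sub>M M) (cont_borel S\<^sub>1 \<Otimes>\<^sub>M cont_borel S\<^sub>2) (\<lambda>(x, y). (?r S\<^sub>1 x, ?r S\<^sub>2 y))"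
    unfolding law_on_def
    by (rule pair_measure_distr[OF m1 m2]) (intro prob_space_imp_sigma_finite prob_space_distr m2)
  have r: "(\<lambda>(x, y). (?r S\<^sub>1 x, ?r S\<^sub>2 y)) \<in> measurable (M \<Otimes>\<^sub>M M) (cont_borel S\<^sub>1 \<Otimes>\<^sub>M cont_borel S\<^sub>2)"
    unfolding split_beta'
    by (intro measurable_Pair measurable_compose[OF measurable_fst m1] measurable_compose[OF measurable_snd m2])
  have merge: "merge S\<^sub>1 S\<^sub>2 \<in> measurable (cont_borel S\<^sub>1 \<Otimes>\<^sub>M cont_borel S\<^sub>2) (cont_borel (S\<^sub>1 \<union> S\<^sub>2))"
  proof (rule measurable_cont_borel)
    show "countable (S\<^sub>1 \<union> S\<^sub>2)" using S by simp
    show "merge S\<^sub>1 S\<^sub>2 x \<in> cont_funs (S\<^sub>1 \<union> S\<^sub>2)" if "x \<in> space (cont_borel S\<^sub>1 \<Otimes>\<^sub>M cont_borel S\<^sub>2)" for x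
      using that S(1-3) by (cases x) (auto simp: space_pair_measure intro: merge_cont_funs)
    fix s assume s: "s \<in> S\<^sub>1 \<union> S\<^sub>2"
    show "(\<lambda>x. merge S\<^sub>1 S\<^sub>2 x s) \<in> borel_measurable (cont_borel S\<^sub>1 \<Otimes>\<^sub>M cont_borel S\<^sub>2)"
    proof (cases "s \<in> S\<^sub>1")
      case True
      then have eq: "(\<lambda>x. merge S\<^sub>1 S\<^sub>2 x s) = (\<lambda>x. fst x s)" by (auto simp: merge_def fun_eq_iff)
      show ?thesis
        unfolding eq by (rule measurable_compose[OF measurable_fst borel_measurable_cont_borel_eval[OF True]])
    next
      case False
      with s have s2: "s \<in> S\<^sub>2" by simp
      then have eq: "(\<lambda>x. merge S\<^sub>1 S\<^sub>2 x s) = (\<lambda>x. snd x s)" using False by (auto simp: merge_def fun_eq_iff)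
      show ?thesis
        unfolding eq by (rule measurable_compose[OF measurable_snd borel_measurable_cont_borel_eval[OF s2]])
    qed
  qed
  have "merge S\<^sub>1 S\<^sub>2 \<circ> (\<lambda>(x, y). (?r S\<^sub>1 x, ?r S\<^sub>2 y)) =
      (\<lambda>p. \<lambda>s\<in>S\<^sub>1 \<union> S\<^sub>2. if s \<in> S\<^sub>2 then \<eta> s (snd p) else \<eta> s (fst p))"
    using S(3) by (auto simp: fun_eq_iff merge_def)
  then show ?thesis unfolding pair distr_distr[OF merge r] by simp
qed

text \<open>Cylinder sets form an algebra generating the product \<sigma>-field. For a cylinder over
  finite \<open>F\<close> the finite bound applies with the blocks
  \<open>F \<inter> S\<^sub>1\<close> and \<open>F \<inter> S\<^sub>2\<close>, and approximation
  extends it.\<close>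

lemma abs_law_diff_le:
  assumes S: "closed S\<^sub>1" "closed S\<^sub>2" "S\<^sub>1 \<inter> S\<^sub>2 = {}" "countable S\<^sub>1" "countable S\<^sub>2"
    and b: "\<And>J\<^sub>1 J\<^sub>2. finite J\<^sub>1 \<Longrightarrow> finite J\<^sub>2 \<Longrightarrow> J\<^sub>1 \<subseteq> S\<^sub>1 \<Longrightarrow> J\<^sub>2 \<subseteq> S\<^sub>2 \<Longrightarrow>
      (\<Sum>s\<in>J\<^sub>1. \<Sum>t\<in>J\<^sub>2. 4 * (2 - extremal_coeff M \<eta> s t)) \<le> b"
    and C: "C \<in> sets (cont_borel (S\<^sub>1 \<union> S\<^sub>2))"
  shows "\<bar>measure (law_on M \<eta> (S\<^sub>1 \<union> S\<^sub>2)) C -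
    measure (distr (law_on M \<eta> S\<^sub>1 \<Otimes>\<^sub>M law_on M \<eta> S\<^sub>2) (cont_borel (S\<^sub>1 \<union> S\<^sub>2)) (merge S\<^sub>1 S\<^sub>2)) C\<bar> \<le> b"
proof -
  interpret prob_space M using ms by (rule simple_max_stableD)
  interpret MM: pair_prob_space M M ..
  let ?S = "S\<^sub>1 \<union> S\<^sub>2"
  let ?Pi = "Pi\<^sub>M ?S (\<lambda>_. borel) :: ('a \<Rightarrow> real) measure"
  let ?f = "\<lambda>\<omega>. restrict (\<lambda>t. \<eta> t \<omega>) ?S"
  let ?g = "\<lambda>p. \<lambda>s\<in>?S. if s \<in> S\<^sub>2 then \<eta> s (snd p) else \<eta> s (fst p)"
  define P where "P = distr M ?Pi ?f"
  define Q where "Q = distr (M \<Otimes>\<^sub>M M) ?Pi ?g"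
  have cS: "countable ?S" using S by simp
  have \<eta>12: "(\<lambda>p. if s \<in> S\<^sub>2 then \<eta> s (snd p) else \<eta> s (fst p)) \<in> borel_measurable (M \<Otimes>\<^sub>M M)" for s
    using simple_max_stableD(2)[OF ms, of s] by (cases "s \<in> S\<^sub>2") auto
  have f: "?f \<in> measurable M ?Pi" and g: "?g \<in> measurable (M \<Otimes>\<^sub>M M) ?Pi"
    by (intro measurable_restrict simple_max_stableD(2)[OF ms] \<eta>12)+
  have cf: "?f \<omega> \<in> cont_funs ?S" if "\<omega> \<in> space M" for \<omega>
    using measurable_space[OF measurable_law_on[OF cS] that] by simp
  have cg: "?g p \<in> cont_funs ?S" if "p \<in> space (M \<Otimes>\<^sub>M M)" for p
  proof -
    have "continuous_on S\<^sub>1 (?g p) \<longleftrightarrow> continuous_on S\<^sub>1 (\<lambda>s. \<eta> s (fst p))"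
      using S(3) by (intro continuous_on_cong) auto
    moreover have "continuous_on S\<^sub>2 (?g p) \<longleftrightarrow> continuous_on S\<^sub>2 (\<lambda>s. \<eta> s (snd p))"
      by (intro continuous_on_cong) auto
    ultimately show ?thesis
      using that simple_max_stableD(3)[OF ms] S(1,2)
      by (auto simp: cont_funs_def space_pair_measure intro!: continuous_on_closed_Un)
  qed
  have g': "?g \<in> measurable (M \<Otimes>\<^sub>M M) (cont_borel ?S)"
    using \<eta>12 by (intro measurable_cont_borel cS cg) auto
  \<comment> \<open>Both fields take values in \<open>cont_funs ?S\<close>, so passing from
    \<open>C\<close> to the product-measurable \<open>C'\<close> changes neither
    probability.\<close>
  obtain C' where C': "C' \<in> sets ?Pi" "C = C' \<inter> cont_funs ?S"
    using C unfolding sets_cont_borel_countable[OF cS] sets_restrict_space by auto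
  have "measure (law_on M \<eta> ?S) C = measure P C'"
    unfolding law_on_def P_def measure_distr[OF measurable_law_on[OF cS] C] measure_distr[OF f C'(1)]
    using cf by (intro arg_cong[where f=prob]) (auto simp: C'(2))
  moreover have "measure (distr (law_on M \<eta> S\<^sub>1 \<Otimes>\<^sub>M law_on M \<eta> S\<^sub>2) (cont_borel ?S) (merge S\<^sub>1 S\<^sub>2)) C = measure Q C'"
    unfolding law_on_product[OF S] Q_def measure_distr[OF g' C] measure_distr[OF g C'(1)]
    using cg by (intro arg_cong[where f="measure _"]) (auto simp: C'(2))
  moreover have "\<bar>measure P C' - measure Q C'\<bar> \<le> b"
  proof -
    \<comment> \<open>The point masses are placeholders with the right \<sigma>-field: the
      interpretation supplies the algebra \<open>R.generator\<close> of cylinder sets, and its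
      measure is never evaluated.\<close>
    interpret R: product_prob_space "\<lambda>_. return borel (0 :: real)" ?S
      by (intro product_prob_space.intro product_sigma_finite.intro product_prob_space_axioms.intro
        prob_space_imp_sigma_finite prob_space_return) auto
    have sets_R: "sets (Pi\<^sub>M I (\<lambda>_. return borel (0 :: real))) = sets (Pi\<^sub>M I (\<lambda>_. borel))" for I :: "'a set"
      by (intro sets_PiM_cong) auto
    have gen: "sets ?Pi = sigma_sets (space (Pi\<^sub>M ?S (\<lambda>_. return borel (0 :: real)))) R.generator"
      using R.sets_PiM_generator by (simp add: sets_R)
    show ?thesis
    proof (rule algebra.abs_measure_diff_le[OF R.algebra_generator])
      show "finite_measure P" "finite_measure Q"
        unfolding P_def Q_def by (intro prob_space.finite_measure prob_space_distr MM.prob_space_distr f g)+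
      show "sets P = sigma_sets (space (Pi\<^sub>M ?S (\<lambda>_. return borel (0 :: real)))) R.generator"
        "sets Q = sigma_sets (space (Pi\<^sub>M ?S (\<lambda>_. return borel (0 :: real)))) R.generator"
        "C' \<in> sigma_sets (space (Pi\<^sub>M ?S (\<lambda>_. return borel (0 :: real)))) R.generator"
        using C'(1) by (simp_all add: P_def Q_def gen)
      fix A assume "A \<in> R.generator"
      then obtain F X where F: "finite F" "F \<subseteq> ?S" and X: "X \<in> sets (Pi\<^sub>M F (\<lambda>_. borel))"
        and A: "A = prod_emb ?S (\<lambda>_. return borel (0 :: real)) F X"
        by (auto elim!: R.generator.cases simp: sets_R)
      have A_sets: "A \<in> sets ?Pi"
        unfolding A using measurable_prod_emb[OF F(2), of X "\<lambda>_. return borel (0 :: real)"] X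
        by (simp add: sets_R)
      have A_iff: "restrict h ?S \<in> A \<longleftrightarrow> restrict h F \<in> X" for h :: "'a \<Rightarrow> real"
        unfolding A prod_emb_def using F(2) by (simp add: Int_absorb1 Int_absorb2)
      let ?J1 = "F \<inter> S\<^sub>1" and ?J2 = "F \<inter> S\<^sub>2"
      have FJ: "?J1 \<union> ?J2 = F" using F(2) by auto
      have gF: "(\<lambda>s\<in>F. if s \<in> ?J2 then \<eta> s (snd p) else \<eta> s (fst p)) =
        (\<lambda>s\<in>F. if s \<in> S\<^sub>2 then \<eta> s (snd p) else \<eta> s (fst p))" for p by (intro restrict_ext) simp
      have "measure P A = prob {\<omega> \<in> space M. restrict (\<lambda>t. \<eta> t \<omega>) F \<in> X}"
        unfolding P_def measure_distr[OF f A_sets] by (intro arg_cong[where f=prob]) (auto simp: A_iff)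
      moreover have "measure Q A = measure (M \<Otimes>\<^sub>M M) {p \<in> space (M \<Otimes>\<^sub>M M).
          (\<lambda>s\<in>F. if s \<in> ?J2 then \<eta> s (snd p) else \<eta> s (fst p)) \<in> X}"
        unfolding Q_def measure_distr[OF g A_sets] gF
        by (intro arg_cong[where f="measure _"]) (auto simp: A_iff)
      moreover have "\<bar>prob {\<omega> \<in> space M. restrict (\<lambda>t. \<eta> t \<omega>) F \<in> X} - measure (M \<Otimes>\<^sub>M M) {p \<in> space (M \<Otimes>\<^sub>M M).
          (\<lambda>s\<in>F. if s \<in> ?J2 then \<eta> s (snd p) else \<eta> s (fst p)) \<in> X}\<bar> \<le>
          (\<Sum>s\<in>?J1. \<Sum>t\<in>?J2. 4 * (2 - extremal_coeff M \<eta> s t))"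
        using max_stable_mixing_finite[OF ms, of ?J1 ?J2 X] F(1) S(3) X unfolding FJ by blast
      ultimately show "\<bar>measure P A - measure Q A\<bar> \<le> b"
        using b[of ?J1 ?J2] F(1) by simp
    qed
  qed
  ultimately show ?thesis by simp
qed

end

theorem corollary2p2:
  fixes M :: "'w measure"
    and \<eta> :: "'a::metric_space \<Rightarrow> 'w \<Rightarrow> real"
    and S\<^sub>1 S\<^sub>2 :: "'a set"
  assumes "locally compact (UNIV :: 'a set)"
    and "simple_max_stable M \<eta>"
    and "closed S\<^sub>1" and "closed S\<^sub>2" and "S\<^sub>1 \<inter> S\<^sub>2 = {}"
    and "countable S\<^sub>1" and "countable S\<^sub>2"
  shows "ereal (mixing_coeff M \<eta> S\<^sub>1 S\<^sub>2)
      \<le> 4 * (\<Sum>\<^sub>\<infinity>s\<^sub>1\<in>S\<^sub>1. \<Sum>\<^sub>\<infinity>s\<^sub>2\<in>S\<^sub>2. ereal (2 - extremal_coeff M \<eta> s\<^sub>1 s\<^sub>2))"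
proof -
  let ?d = "\<lambda>s t. 2 - extremal_coeff M \<eta> s t"
  define X where "X = (\<Sum>\<^sub>\<infinity>s\<^sub>1\<in>S\<^sub>1. \<Sum>\<^sub>\<infinity>s\<^sub>2\<in>S\<^sub>2. ereal (?d s\<^sub>1 s\<^sub>2))"
  have nonneg: "0 \<le> ereal (?d s t)" for s t
    using max_stable_extremal_coeff(3)[OF assms(2)] by simp
  have inner: "0 \<le> (\<Sum>\<^sub>\<infinity>t\<in>S\<^sub>2. ereal (?d s t))" for s by (intro infsum_nonneg nonneg)
  have "0 \<le> X" unfolding X_def by (intro infsum_nonneg inner)
  \<comment> \<open>An infinite sum makes the claim trivial. A finite one dominates all its finite
    partial sums, as the terms are nonnegative by
    \<open>extremal_coeff M \<eta> s t \<le> 2\<close>.\<close>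
  then consider "X = \<infinity>" | x where "X = ereal x" by (cases X) auto
  then have "ereal (mixing_coeff M \<eta> S\<^sub>1 S\<^sub>2) \<le> 4 * X"
  proof cases
    case 1
    then show ?thesis by simp
  next
    case (2 x)
    have "(\<Sum>s\<in>J\<^sub>1. \<Sum>t\<in>J\<^sub>2. 4 * ?d s t) \<le> 4 * x"
      if J: "finite J\<^sub>1" "finite J\<^sub>2" "J\<^sub>1 \<subseteq> S\<^sub>1" "J\<^sub>2 \<subseteq> S\<^sub>2" for J\<^sub>1 J\<^sub>2
    proof -
      have "(\<Sum>s\<in>J\<^sub>1. \<Sum>t\<in>J\<^sub>2. ereal (?d s t)) \<le> (\<Sum>s\<in>J\<^sub>1. \<Sum>\<^sub>\<infinity>t\<in>S\<^sub>2. ereal (?d s t))"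
        by (intro sum_mono nonneg_sum_le_infsum_ereal nonneg J)
      also have "\<dots> \<le> X"
        unfolding X_def by (intro nonneg_sum_le_infsum_ereal inner J)
      finally have "(\<Sum>s\<in>J\<^sub>1. \<Sum>t\<in>J\<^sub>2. ?d s t) \<le> x" by (simp add: 2)
      then have "4 * (\<Sum>s\<in>J\<^sub>1. \<Sum>t\<in>J\<^sub>2. ?d s t) \<le> 4 * x" by simp
      then show ?thesis by (simp only: sum_distrib_left)
    qed
    then have "mixing_coeff M \<eta> S\<^sub>1 S\<^sub>2 \<le> 4 * x"
      unfolding mixing_coeff_def
      by (intro cSUP_least abs_law_diff_le[OF assms(2-7)]) auto
    then show ?thesis by (simp add: 2)
  qed
  then show ?thesis by (simp only: X_def)
qed

end
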